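(* Let $\Theta_{\mathrm{stab}}:=\{(P,K)\in\mathbb{S}^n\times\mathbb{R}^{m\times n}\mid P>0\}$ and let $M_{\mathrm{stab}}:\Theta_{\mathrm{stab}}\to\mathbb{S}^{n,n+m}$ be $$M_{\mathrm{stab}}(P,K):=\begin{bmatrix}P&0&0\\ 0&-P&-PK^\top\\ 0&-KP&-KPK^\top\end{bmatrix}.$$ Let $Q\in\mathbb{S}^{n,n+m}$ be the data-dependent matrix defined in the context. The data $\mathcal{D}=(U_-,X)$ are informative for $M_{\mathrm{stab}}$-control with respect to $\mathcal{W}_{\mathrm F}(\Phi)$ if and only if there exist an $n\times n$ matrix $P>0$, an $L\in\mathbb{R}^{m\times n}$ and a scalar $\beta>0$ such that $$\begin{bmatrix}P-\beta I&0&0&0\\ 0&-P&-L^\top&0\\ 0&-L&0&L\\ 0&0&L^\top&P\end{bmatrix}-\begin{bmatrix}Q&0\\ 0&0\end{bmatrix}\ge 0.\qquad(\ast)$$ Moreover, if $P$ and $L$ (with $P>0$ and some $\beta>0$) satisfy $(\ast)$, then $K:=LP^{-1}$ is a stabilizing feedback gain for all $(A,B)\in\Sigma_{\mathcal D}(\mathcal{W}_{\mathrm F}(\Phi))$, i.e. $A+BK$ has all eigenvalues in the open unit disc for every such $(A,B)$.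
   Context: Notation. All matrices are real. $\mathbb{S}^n$: symmetric $n\times n$ matrices; $\ge,>,\le,<$ between symmetric matrices refer to (semi)definiteness. $\mathbb{S}^{p,q}$: symmetric $(p+q)\times(p+q)$ matrices partitioned as $\Pi=\begin{bmatrix}\Pi_{11}&\Pi_{12}\\ \Pi_{21}&\Pi_{22}\end{bmatrix}$ with $\Pi_{11}\in\mathbb{S}^p$, $\Pi_{22}\in\mathbb{S}^q$. $Y^\dagger$ is the Moore-Penrose pseudoinverse, $\otimes$ the Kronecker product, $\operatorname{vec}(Y)$ the column-stacking vectorization. $\Pi|\Pi_{22}:=\Pi_{11}-\Pi_{12}\Pi_{22}^{\dagger}\Pi_{21}$, and $\mathbf{\Pi}_{p,q}:=\{\Pi\in\mathbb{S}^{p,q}\mid \Pi_{22}\le 0,\ \ker\Pi_{22}\subseteq\ker\Pi_{12},\ \Pi|\Pi_{22}\ge 0\}$. Data and noise model. Let $n,m,T$ be positive integers. The data $\mathcal{D}=(U_-,X)$ consist of $U_-=[u(0)\ \cdots\ u(T-1)]\in\mathbb{R}^{m\times T}$ and $X=[x(0)\ \cdots\ x(T)]\in\mathbb{R}^{n\times(T+1)}$; put $X_-=[x(0)\ \cdots\ x(T-1)]$, $X_+=[x(1)\ \cdots\ x(T)]$. Let $\Phi\in\mathbf{\Pi}_{1,nT}$ be given, with $\Phi_{22}=\phi\otimes I_n$ for some $\phi\in\mathbb{S}^T$, and let $$\mathcal{W}_{\mathrm F}(\Phi):=\Big\{W\in\mathbb{R}^{n\times T}\ \Big|\ \begin{bmatrix}1\\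 \operatorname{vec}(W)\end{bmatrix}^{\top}\Phi\begin{bmatrix}1\\ \operatorname{vec}(W)\end{bmatrix}\ge 0\Big\}.$$ The set of data-compatible systems is $\Sigma_{\mathcal D}(\mathcal{W}_{\mathrm F}(\Phi)):=\{(A,B)\in\mathbb{R}^{n\times n}\times\mathbb{R}^{n\times m}\mid X_+=AX_-+BU_-+W\text{ for some }W\in\mathcal{W}_{\mathrm F}(\Phi)\}$. The data are generated by a true (unknown) system $(A_s,B_s)$ with noise matrix in $\mathcal{W}_{\mathrm F}(\Phi)$, i.e. $(A_s,B_s)\in\Sigma_{\mathcal D}(\mathcal{W}_{\mathrm F}(\Phi))$. Informativity. For a set $\Theta$ and $M:\Theta\to\mathbb{S}^{n,n+m}$ with $M_{22}(\theta)\le0$ for all $\theta$, the data are informative for $M$-control with respect to $\mathcal{W}_{\mathrm F}(\Phi)$ if there exists $\theta\in\Theta$ such that $$\begin{bmatrix}I\\ A^\top\\ B^\top\end{bmatrix}^{\top}M(\theta)\begin{bmatrix}I\\ A^\top\\ B^\top\end{bmatrix}>0\quad\text{for all }(A,B)\in\Sigma_{\mathcal D}(\mathcal{W}_{\mathrm F}(\Phi)).$$ The matrices $N$ and $Q$. Let $$E:=\begin{bmatrix}1&0\\ \operatorname{vec}(X_+)&-\begin{bmatrix}X_-\\ U_-\end{bmatrix}^{\top}\otimes I_n\end{bmatrix},\qquad N:=E^{\top}\Phi E\in\mathbb{S}^{1,n(n+m)},$$ $$Q_{22}:=\begin{bmatrix}X_-\\ U_-\end{bmatrix}\phi\begin{bmatrix}X_-\\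 U_-\end{bmatrix}^{\top},\qquad Q:=\begin{bmatrix}(N|N_{22})I_n+Q_{12}Q_{22}^{\dagger}Q_{21}&Q_{12}\\ Q_{21}&Q_{22}\end{bmatrix}\in\mathbb{S}^{n,n+m},$$ where $Q_{12}\in\mathbb{R}^{n\times(n+m)}$ is determined by $\operatorname{vec}(Q_{12})=N_{21}$ and $Q_{21}=Q_{12}^\top$. In the $4\times4$ block inequality of the claim the diagonal blocks have sizes $n,n,m,n$, and $Q$ is padded with zeros in the last $n$ rows and columns. *)

theory Defs
  imports "HOL-Analysis.Analysis"
begin

definition psd :: "real^'a^'a \<Rightarrow> bool" where
  "psd A \<longleftrightarrow> transpose A = A \<and> (\<forall>v. 0 \<le> v \<bullet> (A *v v))"

definition pd :: "real^'a^'a \<Rightarrow> bool" where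
  "pd A \<longleftrightarrow> transpose A = A \<and> (\<forall>v. v \<noteq> 0 \<longrightarrow> 0 < v \<bullet> (A *v v))"

definition nsd :: "real^'a^'a \<Rightarrow> bool" where
  "nsd A \<longleftrightarrow> psd (- A)"

text \<open>Block matrices are indexed by sum types; the left summand is the first block.\<close>

definition vcat :: "real^'c^'a \<Rightarrow> real^'c^'b \<Rightarrow> real^'c^('a + 'b)" where
  "vcat A B = (\<chi> i. case i of Inl k \<Rightarrow> A $ k | Inr k \<Rightarrow> B $ k)"

definition hcat :: "real^'a^'c \<Rightarrow> real^'b^'c \<Rightarrow> real^('a + 'b)^'c" where
  "hcat A B = (\<chi> i j. case j of Inl k \<Rightarrow> A $ i $ k | Inr k \<Rightarrow> B $ i $ k)"

definition block :: "real^'a^'c \<Rightarrow> real^'b^'c \<Rightarrow> real^'a^'d \<Rightarrow> real^'b^'d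
    \<Rightarrow> real^('a + 'b)^('c + 'd)" where
  "block A B C D = vcat (hcat A B) (hcat C D)"

definition block11 :: "real^('p + 'q::finite)^('p + 'q) \<Rightarrow> real^'p^'p" where
  "block11 A = (\<chi> i j. A $ Inl i $ Inl j)"

definition block12 :: "real^('p + 'q)^('p + 'q) \<Rightarrow> real^'q^'p" where
  "block12 A = (\<chi> i j. A $ Inl i $ Inr j)"

definition block21 :: "real^('p + 'q)^('p + 'q) \<Rightarrow> real^'p^'q" where
  "block21 A = (\<chi> i j. A $ Inr i $ Inl j)"

definition block22 :: "real^('p::finite + 'q)^('p + 'q) \<Rightarrow> real^'q^'q" where
  "block22 A = (\<chi> i j. A $ Inr i $ Inr j)"

text \<open>The entry in row \<open>i\<close> and column \<open>j\<close> of \<open>Y\<close> has index \<open>(j, i)\<close> in the vectorization: under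
  the lexicographic order on pairs this is column stacking. The same order makes \<open>kron\<close> the
  standard Kronecker product.\<close>

definition vectorize :: "real^'c^'r \<Rightarrow> real^('c \<times> 'r)" where
  "vectorize Y = (\<chi> k. Y $ snd k $ fst k)"

definition kron :: "real^'b^'a \<Rightarrow> real^'d^'c \<Rightarrow> real^('b \<times> 'd)^('a \<times> 'c)" where
  "kron A B = (\<chi> r c. A $ fst r $ fst c * B $ snd r $ snd c)"

definition is_pinv :: "real^'a^'b \<Rightarrow> real^'b^'a \<Rightarrow> bool" where
  "is_pinv A G \<longleftrightarrow> A ** G ** A = A \<and> G ** A ** G = G
     \<and> transpose (A ** G) = A ** G \<and> transpose (G ** A) = G ** A"

text \<open>The four Penrose equations have exactly one solution for every real matrix.\<close>

definition pinv :: "real^'a^'b \<Rightarrow> real^'b^'a" where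
  "pinv A = (THE G. is_pinv A G)"

lemma is_pinv_unique:
  assumes G: "is_pinv A G" and H: "is_pinv A H"
  shows "G = H"
proof -
  have AG: "A ** G = A ** H"
  proof -
    have "A ** G = transpose (A ** G)" using G by (simp add: is_pinv_def)
    also have "\<dots> = transpose ((A ** H) ** (A ** G))"
      using H by (simp add: is_pinv_def matrix_mul_assoc)
    also have "\<dots> = transpose (A ** G) ** transpose (A ** H)" by (simp add: matrix_transpose_mul)
    also have "\<dots> = (A ** G) ** (A ** H)" using G H by (simp add: is_pinv_def)
    also have "\<dots> = A ** H" using G by (simp add: is_pinv_def matrix_mul_assoc)
    finally show ?thesis .
  qed
  have GA: "G ** A = H ** A"
  proof -
    have "G ** A = transpose (G ** A)" using G by (simp add: is_pinv_def)
    also have "\<dots> = transpose ((G ** A) ** (H ** A))"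
      using H by (metis is_pinv_def matrix_mul_assoc)
    also have "\<dots> = transpose (H ** A) ** transpose (G ** A)" by (simp add: matrix_transpose_mul)
    also have "\<dots> = (H ** A) ** (G ** A)" using G H by (simp add: is_pinv_def)
    also have "\<dots> = H ** A" using G by (metis is_pinv_def matrix_mul_assoc)
    finally show ?thesis .
  qed
  have "G = G ** A ** G" using G by (simp add: is_pinv_def)
  also have "\<dots> = H ** A ** H" using AG GA by (metis matrix_mul_assoc)
  also have "\<dots> = H" using H by (simp add: is_pinv_def)
  finally show ?thesis .
qed

definition gen_schur :: "real^('p + 'q::finite)^('p + 'q) \<Rightarrow> real^'p^'p" where
  "gen_schur A = block11 A - block12 A ** pinv (block22 A) ** block21 A"

definition Pi_set :: "(real^('p::finite + 'q::finite)^('p + 'q)) set" where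
  "Pi_set = {A. transpose A = A \<and> nsd (block22 A)
     \<and> (\<forall>v. block22 A *v v = 0 \<longrightarrow> block12 A *v v = 0) \<and> psd (gen_schur A)}"

text \<open>The linearly ordered finite type \<open>'t\<close>, of cardinality \<open>T\<close>, indexes the time instants
  \<open>0, \<dots>, T - 1\<close> in increasing order. The data are the samples \<open>u 0, \<dots>, u (T - 1)\<close> and
  \<open>x 0, \<dots>, x T\<close>; the remaining values of the sequences \<open>u\<close> and \<open>x\<close> are never used.\<close>

definition time :: "'t::{finite, linorder} \<Rightarrow> nat" where
  "time j = card {i. i < j}"

definition U_minus :: "(nat \<Rightarrow> real^'m) \<Rightarrow> real^'t::{finite, linorder}^'m" where
  "U_minus u = (\<chi> i j. u (time j) $ i)"

definition X_minus :: "(nat \<Rightarrow> real^'n) \<Rightarrow> real^'t::{finite, linorder}^'n" where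
  "X_minus x = (\<chi> i j. x (time j) $ i)"

definition X_plus :: "(nat \<Rightarrow> real^'n) \<Rightarrow> real^'t::{finite, linorder}^'n" where
  "X_plus x = (\<chi> i j. x (Suc (time j)) $ i)"

lemma bij_betw_time: "bij_betw time (UNIV :: 't::{finite, linorder} set) {..<CARD('t)}"
proof -
  have mono: "time i < time j" if "i < j" for i j :: 't
    unfolding time_def using that by (intro psubset_card_mono) auto
  have inj: "inj (time :: 't \<Rightarrow> nat)"
    by (rule injI) (metis mono linorder_neqE less_irrefl)
  have "range (time :: 't \<Rightarrow> nat) \<subseteq> {..<CARD('t)}"
    by (auto simp: time_def intro!: psubset_card_mono)
  moreover have "card (range (time :: 't \<Rightarrow> nat)) = CARD('t)"
    using inj by (simp add: card_image)
  ultimately have "range (time :: 't \<Rightarrow> nat) = {..<CARD('t)}"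
    by (intro card_subset_eq) auto
  with inj show ?thesis by (simp add: bij_betw_def)
qed

definition one_vec :: "real^'k \<Rightarrow> real^(1 + 'k)" where
  "one_vec w = (\<chi> k. case k of Inl _ \<Rightarrow> 1 | Inr p \<Rightarrow> w $ p)"

definition W_F :: "real^(1 + 't \<times> 'n)^(1 + 't \<times> 'n) \<Rightarrow> (real^'t^'n) set" where
  "W_F \<Phi> = {W. 0 \<le> one_vec (vectorize W) \<bullet> (\<Phi> *v one_vec (vectorize W))}"

definition Sigma_D :: "(nat \<Rightarrow> real^'m) \<Rightarrow> (nat \<Rightarrow> real^'n) \<Rightarrow> (real^'t::{finite, linorder}^'n) set
    \<Rightarrow> ((real^'n^'n) \<times> (real^'m^'n)) set" where
  "Sigma_D u x \<W> = {(A, B). \<exists>W\<in>\<W>. X_plus x = A ** X_minus x + B ** U_minus u + W}"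

text \<open>The definition is meant for families \<open>M\<close> of symmetric matrices whose lower right block is
  negative semidefinite on \<open>\<Theta>\<close>; see \<open>M_stab_admissible\<close> below.\<close>

definition informative :: "'th set \<Rightarrow> ('th \<Rightarrow> real^('n + ('n + 'm))^('n + ('n + 'm)))
    \<Rightarrow> (nat \<Rightarrow> real^'m) \<Rightarrow> (nat \<Rightarrow> real^'n) \<Rightarrow> (real^'t::{finite, linorder}^'n) set \<Rightarrow> bool" where
  "informative \<Theta> M u x \<W> \<longleftrightarrow> (\<exists>\<theta>\<in>\<Theta>. \<forall>(A, B) \<in> Sigma_D u x \<W>.
     pd (transpose (vcat (mat 1) (vcat (transpose A) (transpose B))) ** M \<theta>
           ** vcat (mat 1) (vcat (transpose A) (transpose B))))"

definition E_mat :: "(nat \<Rightarrow> real^'m) \<Rightarrow> (nat \<Rightarrow> real^'n)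
    \<Rightarrow> real^(1 + ('n + 'm) \<times> 'n)^(1 + 't::{finite, linorder} \<times> 'n)" where
  "E_mat u x = block (mat 1) 0
     (columnvector (vectorize (X_plus x)))
     (- kron (transpose (vcat (X_minus x) (U_minus u))) (mat 1))"

definition N_mat :: "(nat \<Rightarrow> real^'m) \<Rightarrow> (nat \<Rightarrow> real^'n)
    \<Rightarrow> real^(1 + 't::{finite, linorder} \<times> 'n)^(1 + 't \<times> 'n)
    \<Rightarrow> real^(1 + ('n + 'm) \<times> 'n)^(1 + ('n + 'm) \<times> 'n)" where
  "N_mat u x \<Phi> = transpose (E_mat u x) ** \<Phi> ** E_mat u x"

definition Q12 :: "(nat \<Rightarrow> real^'m) \<Rightarrow> (nat \<Rightarrow> real^'n)
    \<Rightarrow> real^(1 + 't::{finite, linorder} \<times> 'n)^(1 + 't \<times> 'n) \<Rightarrow> real^('n + 'm)^'n" where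
  "Q12 u x \<Phi> = (\<chi> i j. block21 (N_mat u x \<Phi>) $ (j, i) $ 1)"

lemma vectorize_Q12: "columnvector (vectorize (Q12 u x \<Phi>)) = block21 (N_mat u x \<Phi>)"
  by (simp add: columnvector_def vectorize_def Q12_def vec_eq_iff split_beta forall_1)

definition Q22 :: "(nat \<Rightarrow> real^'m) \<Rightarrow> (nat \<Rightarrow> real^'n) \<Rightarrow> real^'t::{finite, linorder}^'t::{finite, linorder}
    \<Rightarrow> real^('n + 'm)^('n + 'm)" where
  "Q22 u x \<phi> = vcat (X_minus x) (U_minus u) ** \<phi> ** transpose (vcat (X_minus x) (U_minus u))"

definition Q_mat :: "(nat \<Rightarrow> real^'m) \<Rightarrow> (nat \<Rightarrow> real^'n)
    \<Rightarrow> real^(1 + 't::{finite, linorder} \<times> 'n)^(1 + 't \<times> 'n) \<Rightarrow> real^'t::{finite, linorder}^'t::{finite, linorder}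
    \<Rightarrow> real^('n + ('n + 'm))^('n + ('n + 'm))" where
  "Q_mat u x \<Phi> \<phi> = block
     (gen_schur (N_mat u x \<Phi>) $ 1 $ 1 *\<^sub>R mat 1
        + Q12 u x \<Phi> ** pinv (Q22 u x \<phi>) ** transpose (Q12 u x \<Phi>))
     (Q12 u x \<Phi>)
     (transpose (Q12 u x \<Phi>))
     (Q22 u x \<phi>)"

definition Theta_stab :: "((real^'n^'n) \<times> (real^'n^'m)) set" where
  "Theta_stab = {(P, K). pd P}"

definition M_stab :: "(real^'n^'n) \<times> (real^'n^'m) \<Rightarrow> real^('n + ('n + 'm))^('n + ('n + 'm))" where
  "M_stab = (\<lambda>(P, K). block P 0 0
     (block (- P) (- (P ** transpose K)) (- (K ** P)) (- (K ** P ** transpose K))))"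

lemma block_sub [simp]:
  "block11 (block A B C D) = A" "block12 (block A B C D) = B"
  "block21 (block A B C D) = C" "block22 (block A B C D) = D"
  by (simp_all add: block11_def block12_def block21_def block22_def block_def vcat_def hcat_def)

lemma transpose_block:
  "transpose (block A B C D) = block (transpose A) (transpose C) (transpose B) (transpose D)"
  by (auto simp: transpose_def block_def vcat_def hcat_def vec_eq_iff split: sum.splits)

lemma vcat_mult_left: "vcat A B ** C = vcat (A ** C) (B ** C)"
  by (auto simp: vcat_def matrix_matrix_mult_def vec_eq_iff split: sum.splits)

lemma vcat_mult_transpose_vcat:
  "vcat A B ** transpose (vcat C D)
     = block (A ** transpose C) (A ** transpose D) (B ** transpose C) (B ** transpose D)"
  by (auto simp: block_def vcat_def hcat_def matrix_matrix_mult_def transpose_def vec_eq_iff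
      split: sum.splits)

lemma transpose_uminus: "transpose (- A) = - transpose (A :: real^'a^'b)"
  by (simp add: transpose_def vec_eq_iff)

lemma uminus_block: "- block A B C D = block (- A) (- B) (- C) (- D)"
  by (auto simp: block_def vcat_def hcat_def vec_eq_iff split: sum.splits)

lemma transpose_0: "transpose (0 :: real^'a^'b) = 0"
  by (simp add: transpose_def vec_eq_iff)

lemma M_stab_admissible:
  assumes "\<theta> \<in> Theta_stab"
  shows "transpose (M_stab \<theta>) = M_stab \<theta>" and "nsd (block22 (M_stab \<theta>))"
proof -
  obtain P K where \<theta>: "\<theta> = (P, K)" by (cases \<theta>)
  with assms have P: "transpose P = P" and pos: "v \<noteq> 0 \<Longrightarrow> 0 < v \<bullet> (P *v v)" for v
    by (auto simp: Theta_stab_def pd_def)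
  show "transpose (M_stab \<theta>) = M_stab \<theta>"
    by (simp add: \<theta> M_stab_def transpose_block transpose_uminus matrix_transpose_mul P
        matrix_mul_assoc transpose_0)
  let ?G = "vcat (mat 1) K"
  let ?M = "?G ** P ** transpose ?G"
  have "?M = vcat P (K ** P) ** transpose ?G"
    by (simp add: vcat_mult_left)
  also have "\<dots> = block P (P ** transpose K) (K ** P) (K ** P ** transpose K)"
    by (simp add: vcat_mult_transpose_vcat transpose_mat)
  finally have M: "- block22 (M_stab \<theta>) = ?M"
    by (simp add: \<theta> M_stab_def uminus_block)
  have "0 \<le> v \<bullet> (?M *v v)" for v
  proof -
    have "v \<bullet> (?M *v v) = (transpose ?G *v v) \<bullet> (P *v (transpose ?G *v v))"
      by (simp add: dot_lmul_matrix matrix_vector_mul_assoc [symmetric])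
    also have "\<dots> \<ge> 0"
      using pos [of "transpose ?G *v v"] by (cases "transpose ?G *v v = 0") auto
    finally show ?thesis .
  qed
  moreover have "transpose ?M = ?M"
    by (simp add: matrix_transpose_mul P matrix_mul_assoc)
  ultimately show "nsd (block22 (M_stab \<theta>))"
    by (simp add: nsd_def psd_def M)
qed

definition schur_stable :: "real^'n^'n \<Rightarrow> bool" where
  "schur_stable A \<longleftrightarrow> (\<forall>(c::complex) (v::complex^'n).
     v \<noteq> 0 \<and> map_matrix complex_of_real A *v v = c *s v \<longrightarrow> cmod c < 1)"

definition LMI_stab :: "real^'n^'n \<Rightarrow> real^'n^'m \<Rightarrow> real \<Rightarrow> real^('n + ('n + 'm))^('n + ('n + 'm))
    \<Rightarrow> bool" where
  "LMI_stab P L \<beta> Q \<longleftrightarrow> psd (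
     block
       (block (P - \<beta> *\<^sub>R mat 1) 0 0 (block (- P) (- transpose L) (- L) 0))
       (vcat 0 (vcat 0 L))
       (hcat 0 (hcat 0 (transpose L)))
       P
     - block Q 0 0 (0 :: real^'n^'n))"

end

theory Submission
  imports Defs
begin

text \<open>Put \<open>R = - Q\<^sub>2\<^sub>2\<close>, let \<open>C\<^sup>T = - Q\<^sub>1\<^sub>2 Q\<^sub>2\<^sub>2\<^sup>\<dagger>\<close> and let \<open>s\<close> be the Schur complement of
  \<open>N\<close>. Completing the square, \<open>(A, B)\<close> is compatible with the data iff
  \<open>\<Delta> = [A B] - C\<^sup>T\<close> satisfies \<open>tr (\<Delta> R \<Delta>\<^sup>T) \<le> s\<close>, whereas the quadratic form of \<open>Q\<close> at
  \<open>(v, y)\<close> is \<open>s \<bar>v\<bar>\<^sup>2 - (y - C v)\<^sup>T R (y - C v)\<close>. Since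
  \<open>\<Delta> R \<Delta>\<^sup>T \<le> tr (\<Delta> R \<Delta>\<^sup>T) I\<close>, the matrix inequality evaluated at \<open>y = [A B]\<^sup>T v\<close> yields the
  Lyapunov inequality for all compatible systems. Conversely, every vector \<open>w\<close> with
  \<open>w\<^sup>T R w \<le> s \<bar>v\<bar>\<^sup>2\<close> is \<open>\<Delta>\<^sup>T v\<close> for the rank-one matrix \<open>\<Delta> = v w\<^sup>T / \<bar>v\<bar>\<^sup>2\<close> in the ball, so
  informativity becomes an implication between two quadratic forms. The S-lemma then
  supplies a multiplier; it is positive because \<open>P\<close> is, so \<open>P\<close> can be rescaled to absorb it.\<close>

section \<open>Quadratic forms\<close>

declare transpose_matrix_vector [simp del]

lemma matrix_add_rdistrib: "(B + C) ** A = B ** A + C ** (A :: real^'a^'b)"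
  by (simp add: matrix_matrix_mult_def vec_eq_iff sum.distrib distrib_right)

lemma matrix_diff_ldistrib: "A ** (B - C) = A ** B - A ** (C :: real^'a^'b)"
  by (simp add: matrix_matrix_mult_def vec_eq_iff sum_subtractf right_diff_distrib)

lemma matrix_diff_rdistrib: "(B - C) ** A = B ** A - C ** (A :: real^'a^'b)"
  by (simp add: matrix_matrix_mult_def vec_eq_iff sum_subtractf left_diff_distrib)

lemma matrix_vector_mult_uminus_left: "(- A) *v x = - ((A :: real^'a^'b) *v x)"
  by (simp add: matrix_vector_mult_def vec_eq_iff sum_negf)

lemma matrix_vector_mult_uminus_right: "A *v (- x) = - ((A :: real^'a^'b) *v x)"
  by (simp add: matrix_vector_mult_def vec_eq_iff sum_negf)

definition qform :: "real^'a^'a \<Rightarrow> real^'a \<Rightarrow> real" where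
  "qform A x = x \<bullet> (A *v x)"

lemma inner_symmetric_matrix:
  fixes A :: "real^'a^'a"
  assumes "transpose A = A"
  shows "x \<bullet> (A *v y) = (A *v x) \<bullet> y"
  by (metis assms dot_lmul_matrix transpose_matrix_vector)

lemma inner_transpose_matrix:
  fixes A :: "real^'a^'b"
  shows "x \<bullet> (A *v y) = (transpose A *v x) \<bullet> y"
  by (simp add: dot_lmul_matrix transpose_matrix_vector)

lemma qform_scaleR [simp]: "qform A (t *\<^sub>R x) = t\<^sup>2 * qform A x"
  by (simp add: qform_def matrix_vector_mult_scaleR power2_eq_square)

lemma qform_0 [simp]: "qform A 0 = 0"
  by (simp add: qform_def)

lemma qform_add:
  assumes "transpose A = A"
  shows "qform A (x + y) = qform A x + 2 * (x \<bullet> (A *v y)) + qform A y"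
  using inner_symmetric_matrix[OF assms, of y x]
  by (simp add: qform_def matrix_vector_right_distrib inner_add inner_commute)

lemma qform_diff:
  assumes "transpose A = A"
  shows "qform A (x - y) = qform A x - 2 * (x \<bullet> (A *v y)) + qform A y"
  using qform_add[OF assms, of x "- y"]
  by (simp add: qform_def matrix_vector_mult_uminus_right)

lemma qform_uminus_matrix [simp]: "qform (- A) x = - qform A x"
  by (simp add: qform_def matrix_vector_mult_uminus_left)

lemma qform_congruence: "qform (transpose E ** A ** E) x = qform A (E *v x)"
  by (simp add: qform_def matrix_vector_mul_assoc[symmetric] inner_transpose_matrix[of _ E, symmetric]
      inner_transpose_matrix[of _ "transpose E"])

lemma continuous_on_qform [continuous_intros]:
  "continuous_on S f \<Longrightarrow> continuous_on S (\<lambda>x. qform A (f x))"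
  unfolding qform_def
  by (intro continuous_intros bounded_linear.continuous_on[OF matrix_vector_mul_bounded_linear])

section \<open>Kernel and coercivity of definite forms\<close>

lemma psd_iff: "psd A \<longleftrightarrow> transpose A = A \<and> (\<forall>v. 0 \<le> qform A v)"
  by (simp add: psd_def qform_def)

lemma pd_iff: "pd A \<longleftrightarrow> transpose A = A \<and> (\<forall>v. v \<noteq> 0 \<longrightarrow> 0 < qform A v)"
  by (simp add: pd_def qform_def)

lemma pd_imp_psd: "pd A \<Longrightarrow> psd A"
  unfolding pd_iff psd_iff by (metis less_eq_real_def qform_0)

text \<open>Otherwise a step from \<open>x\<close> against \<open>y = A x\<close> changes the form
  by \<open>- 2 t |y|^2 + t^2 qform A y\<close>, which is negative for small
  \<open>t > 0\<close>.\<close>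

lemma psd_kernel:
  assumes A: "psd A" and x: "qform A x = 0"
  shows "A *v x = 0"
proof (rule ccontr)
  define y where "y = A *v x"
  assume "A *v x \<noteq> 0"
  then have yy: "0 < y \<bullet> y" by (simp add: y_def)
  have sym: "transpose A = A" and nn: "\<And>v. 0 \<le> qform A v" using A by (auto simp: psd_iff)
  \<comment> \<open>The added 1 keeps the denominator positive and gives
    \<open>t * qform A y <= |y|^2\<close>.\<close>
  define t where "t = (y \<bullet> y) / (qform A y + 1)"
  have q: "qform A y + 1 > 0" using nn[of y] by simp
  have t: "t > 0" using yy q by (simp add: t_def)
  have "0 \<le> qform A (x - t *\<^sub>R y)" by (rule nn)
  also have "\<dots> = - 2 * t * (y \<bullet> y) + t\<^sup>2 * qform A y"
    using inner_symmetric_matrix[OF sym, of x y]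
    by (simp add: qform_diff[OF sym] x y_def matrix_vector_mult_scaleR)
  also have "\<dots> = t * (t * qform A y - 2 * (y \<bullet> y))"
    by (simp add: power2_eq_square algebra_simps)
  finally have "2 * (y \<bullet> y) \<le> t * qform A y" using t by (simp add: zero_le_mult_iff)
  also have "\<dots> \<le> t * (qform A y + 1)" using t by simp
  also have "\<dots> = y \<bullet> y" using q by (simp add: t_def)
  finally show False using yy by simp
qed

text \<open>The minimum over the compact unit sphere is attained and positive; homogeneity of degree
  two does the rest.\<close>

lemma pd_coercive:
  fixes A :: "real^'a^'a"
  assumes "pd A"
  obtains c where "c > 0" "\<And>x. c * (x \<bullet> x) \<le> qform A x"
proof -
  let ?S = "sphere (0::real^'a) 1"
  have "continuous_on ?S (\<lambda>x. qform A x)" by (intro continuous_intros)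
  moreover have "?S \<noteq> {}" by simp
  ultimately obtain x0 where x0: "x0 \<in> ?S" "\<And>x. x \<in> ?S \<Longrightarrow> qform A x0 \<le> qform A x"
    using continuous_attains_inf[of ?S "\<lambda>x. qform A x"] by auto
  have "x0 \<noteq> 0" using x0(1) by auto
  then have "qform A x0 > 0" using assms by (simp add: pd_iff)
  moreover have "qform A x0 * (x \<bullet> x) \<le> qform A x" for x
  proof (cases "x = 0")
    case False
    have "qform A x0 \<le> qform A ((1 / norm x) *\<^sub>R x)" using False by (intro x0(2)) simp
    also have "\<dots> = qform A x / (x \<bullet> x)"
      by (simp add: power_divide power2_norm_eq_inner)
    finally show ?thesis using False by (simp add: field_simps)
  qed simp
  ultimately show ?thesis using that by blast
qed

section \<open>The pseudoinverse of a symmetric matrix\<close>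

text \<open>\<open>J\<close> is assembled from an orthonormal basis of the kernel, which makes it
  symmetric with range in the kernel; transposing \<open>A ** J = 0\<close> gives
  \<open>J ** A = 0\<close>.\<close>

lemma kernel_projector:
  fixes A :: "real^'a^'a"
  assumes A: "transpose A = A"
  obtains J :: "real^'a^'a" where "transpose J = J" "J ** J = J" "A ** J = 0" "J ** A = 0"
    "\<And>v. A *v v = 0 \<Longrightarrow> J *v v = v"
proof -
  have "subspace {v. A *v v = 0}"
    by (simp add: subspace_def matrix_vector_right_distrib matrix_vector_mult_scaleR)
  then obtain B where B: "B \<subseteq> {v. A *v v = 0}" "pairwise orthogonal B" "\<And>x. x \<in> B \<Longrightarrow> norm x = 1"
      "independent B" "span B = {v. A *v v = 0}"
    by (rule orthonormal_basis_subspace) blast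
  have fin: "finite B" using B(4) independent_imp_finite by blast
  define p where "p v = (\<Sum>b\<in>B. (b \<bullet> v) *\<^sub>R b)" for v
  have lin: "linear p"
    by (rule linearI) (simp_all add: p_def inner_add_right scaleR_add_left sum.distrib scaleR_sum_right)
  define J where "J = matrix p"
  have J: "J *v v = p v" for v by (simp add: J_def matrix_works lin)
  have "p v \<in> span B" for v
    unfolding p_def by (intro span_sum span_scale span_base)
  then have Ap: "A *v p v = 0" for v
    using B(5) by blast
  have sym: "x \<bullet> p y = p x \<bullet> y" for x y
    by (simp add: p_def inner_sum_left inner_sum_right inner_commute mult.commute)
  have bp: "b \<bullet> p v = b \<bullet> v" if b: "b \<in> B" for b v
  proof -
    have "b \<bullet> p v = (\<Sum>a\<in>B. (a \<bullet> v) * (b \<bullet> a))" by (simp add: p_def inner_sum_right)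
    also have "\<dots> = (\<Sum>a\<in>B. if a = b then b \<bullet> v else 0)"
      using B(2) B(3) b
      by (intro sum.cong) (auto simp: pairwise_def orthogonal_def dot_square_norm)
    finally show ?thesis using fin b by simp
  qed
  \<comment> \<open>The residual \<open>v - p v\<close> lies in \<open>span B\<close> and is
    orthogonal to \<open>B\<close>, hence to itself.\<close>
  have fixed: "p v = v" if v: "A *v v = 0" for v
  proof -
    have "v - p v \<in> span B" using v Ap B(5) by (simp add: matrix_vector_mult_diff_distrib)
    moreover have "orthogonal (v - p v) b" if "b \<in> B" for b
      using bp[OF that, of v] by (simp add: orthogonal_def inner_diff_right inner_commute)
    ultimately have "orthogonal (v - p v) (v - p v)" by (rule orthogonal_to_span)
    then show ?thesis by (simp add: orthogonal_self)
  qed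
  have symJ: "transpose J = J"
  proof -
    have "(transpose J *v x - J *v x) \<bullet> y = 0" for x y
      using sym[of x y] inner_transpose_matrix[of x J y] by (simp add: J inner_diff_left)
    then have "transpose J *v x - J *v x = 0" for x
      by (metis inner_eq_zero_iff)
    then show ?thesis by (metis matrix_eq right_minus_eq)
  qed
  have AJ: "A ** J = 0"
    by (subst matrix_eq) (simp add: matrix_vector_mul_assoc[symmetric] J Ap)
  show ?thesis
  proof
    show "transpose J = J" by (fact symJ)
    show "J ** J = J"
      by (subst matrix_eq) (simp add: matrix_vector_mul_assoc[symmetric] J fixed Ap)
    show "A ** J = 0" by (fact AJ)
    show "J ** A = 0"
      using arg_cong[OF AJ, of transpose] by (simp add: matrix_transpose_mul A symJ transpose_0)
    show "J *v v = v" if "A *v v = 0" for v using fixed[OF that] by (simp add: J)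
  qed
qed

text \<open>With \<open>J\<close> the orthogonal projector onto the kernel, the pseudoinverse is
  \<open>(A + J)\<^sup>-\<^sup>1 - J\<close>.\<close>

lemma ex_is_pinv_symmetric:
  fixes A :: "real^'a^'a"
  assumes A: "transpose A = A"
  shows "\<exists>G. is_pinv A G"
proof -
  obtain J :: "real^'a^'a" where J: "transpose J = J" "J ** J = J" "A ** J = 0" "J ** A = 0"
    "\<And>v. A *v v = 0 \<Longrightarrow> J *v v = v"
    using kernel_projector[OF A] by blast
  \<comment> \<open>Applying \<open>J\<close> isolates \<open>J x = 0\<close>; then
    \<open>A x = 0\<close>, so \<open>J\<close> fixes \<open>x\<close> and
    \<open>x = 0\<close>.\<close>
  have "x = 0" if x: "(A + J) *v x = 0" for x
  proof -
    have "J *v ((A + J) *v x) = J *v x"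
      by (simp add: matrix_vector_mul_assoc matrix_add_ldistrib J)
    then have "J *v x = 0" by (simp add: x)
    moreover from this x have "A *v x = 0" by (simp add: matrix_vector_mult_add_rdistrib)
    ultimately show ?thesis using J(5) by metis
  qed
  then obtain H where HL: "H ** (A + J) = mat 1"
    using matrix_left_invertible_ker[of "A + J"] by blast
  then have HR: "(A + J) ** H = mat 1" using matrix_left_right_inverse by blast
  have "H ** J = H ** ((A + J) ** J)" by (simp add: matrix_add_rdistrib J)
  then have HJ: "H ** J = J" by (simp add: matrix_mul_assoc HL)
  have "J ** H = (J ** (A + J)) ** H" by (simp add: matrix_add_ldistrib J)
  then have JH: "J ** H = J" by (simp add: matrix_mul_assoc[symmetric] HR)
  have AH: "A ** H = mat 1 - J" using HR by (simp add: matrix_add_rdistrib JH eq_diff_eq)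
  have HA: "H ** A = mat 1 - J" using HL by (simp add: matrix_add_ldistrib HJ eq_diff_eq)
  have AG: "A ** (H - J) = mat 1 - J" by (simp add: matrix_diff_ldistrib AH J)
  have GA: "(H - J) ** A = mat 1 - J" by (simp add: matrix_diff_rdistrib HA J)
  have t: "transpose (mat 1 - J) = mat 1 - J"
    using J(1) by (simp add: transpose_def vec_eq_iff mat_def)
  have "is_pinv A (H - J)"
    unfolding is_pinv_def AG GA
    by (simp add: t matrix_diff_rdistrib matrix_diff_ldistrib J JH)
  then show ?thesis ..
qed

lemma is_pinv_pinv: "\<exists>G. is_pinv A G \<Longrightarrow> is_pinv A (pinv A)"
  unfolding pinv_def using is_pinv_unique theI' by metis

lemma pinv_eqI: "is_pinv A G \<Longrightarrow> pinv A = G"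
  using is_pinv_pinv is_pinv_unique by blast

text \<open>Transposing \<open>A\<close> and \<open>G\<close> together permutes the Penrose
  equations, so uniqueness applies.\<close>

lemma transpose_pinv_symmetric:
  assumes A: "transpose A = A"
  shows "transpose (pinv A) = pinv A"
proof -
  have G: "is_pinv A (pinv A)" using ex_is_pinv_symmetric[OF A] by (rule is_pinv_pinv)
  have "transpose A ** transpose (pinv A) ** transpose A = transpose (A ** pinv A ** A)"
    and "transpose (pinv A) ** transpose A ** transpose (pinv A) = transpose (pinv A ** A ** pinv A)"
    and "transpose A ** transpose (pinv A) = transpose (pinv A ** A)"
    and "transpose (pinv A) ** transpose A = transpose (A ** pinv A)"
    by (simp_all add: matrix_transpose_mul matrix_mul_assoc)
  then have "is_pinv A (transpose (pinv A))"
    using G by (simp add: is_pinv_def A)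
  then show ?thesis using pinv_eqI by metis
qed

section \<open>The S-lemma and its robust form\<close>

text \<open>For a ratio \<open>f x / g x\<close> with \<open>g x > 0\<close>, the form \<open>f - (f x / g x) g\<close> is affine along the
  line \<open>y + t x\<close>, on which it is nonnegative at the two roots of \<open>g\<close>; if \<open>g y < 0\<close> these roots
  enclose \<open>t = 0\<close>.\<close>

lemma S_lemma:
  fixes f g :: "'a::real_vector \<Rightarrow> real"
  assumes f: "\<And>x y t. f (y + t *\<^sub>R x) = f y + t * f' x y + t\<^sup>2 * f x"
    and g: "\<And>x y t. g (y + t *\<^sub>R x) = g y + t * g' x y + t\<^sup>2 * g x"
    and imp: "\<And>x. 0 \<le> g x \<Longrightarrow> 0 \<le> f x"
    and slater: "0 < g x\<^sub>0"
  shows "\<exists>\<alpha>\<ge>0. \<forall>x. \<alpha> * g x \<le> f x"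
proof -
  \<comment> \<open>The multiplier is the infimum of the ratios over \<open>g > 0\<close>. It
    dominates each ratio with \<open>g y < 0\<close>, because such a ratio is a lower bound of
    \<open>?S\<close>.\<close>
  let ?S = "{f x / g x | x. 0 < g x}"
  define \<alpha> where "\<alpha> = Inf ?S"
  have ne: "?S \<noteq> {}" using slater by auto
  have bdd: "bdd_below ?S" using imp by (auto intro!: bdd_belowI[of _ 0])
  have "0 \<le> \<alpha>" unfolding \<alpha>_def using ne imp by (intro cInf_greatest) auto
  moreover have "\<alpha> * g y \<le> f y" for y
  proof (cases "g y" "0 :: real" rule: linorder_cases)
    case equal
    then show ?thesis using imp[of y] by simp
  next
    case greater
    then have "\<alpha> \<le> f y / g y" unfolding \<alpha>_def using bdd by (intro cInf_lower) auto
    then show ?thesis using greater by (simp add: field_simps)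
  next
    case less
    have "f y / g y \<le> f x / g x" if x: "0 < g x" for x
    proof -
      define \<mu> where "\<mu> = f x / g x"
      define d where "d = sqrt ((g' x y)\<^sup>2 - 4 * g y * g x)"
      have neg: "g y * g x < 0" using less x by (simp add: mult_less_0_iff)
      then have "0 \<le> (g' x y)\<^sup>2 - 4 * g y * g x"
        using zero_le_power2[of "g' x y"] by linarith
      then have d2: "d\<^sup>2 = (g' x y)\<^sup>2 - 4 * g y * g x" by (simp add: d_def)
      have "sqrt ((g' x y)\<^sup>2) < d" unfolding d_def using neg
        by (intro real_sqrt_less_mono) (simp add: mult.commute)
      then have d: "\<bar>g' x y\<bar> < d" by simp
      define t\<^sub>1 where "t\<^sub>1 = (- g' x y - d) / (2 * g x)"
      define t\<^sub>2 where "t\<^sub>2 = (- g' x y + d) / (2 * g x)"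
      have sgn: "t\<^sub>1 < 0" "0 < t\<^sub>2" using d x by (auto simp: t\<^sub>1_def t\<^sub>2_def divide_simps)
      have root: "g (y + t *\<^sub>R x) = 0" if "(2 * g x * t + g' x y)\<^sup>2 = d\<^sup>2" for t
      proof -
        have "4 * g x * g (y + t *\<^sub>R x) = (2 * g x * t + g' x y)\<^sup>2 - d\<^sup>2"
          unfolding d2 by (simp add: g power2_eq_square algebra_simps)
        then show ?thesis using that x by simp
      qed
      have h: "0 \<le> f y - \<mu> * g y + t * (f' x y - \<mu> * g' x y)"
        if "(2 * g x * t + g' x y)\<^sup>2 = d\<^sup>2" for t
      proof -
        have "0 \<le> f (y + t *\<^sub>R x) - \<mu> * g (y + t *\<^sub>R x)"
          using root[OF that] imp[of "y + t *\<^sub>R x"] by simp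
        also have "\<dots> = f y - \<mu> * g y + t * (f' x y - \<mu> * g' x y)"
          using x by (simp add: f g \<mu>_def algebra_simps)
        finally show ?thesis .
      qed
      let ?a = "f y - \<mu> * g y" and ?b = "f' x y - \<mu> * g' x y"
      have "2 * g x * t\<^sub>1 + g' x y = - d" "2 * g x * t\<^sub>2 + g' x y = d"
        using x by (simp_all add: t\<^sub>1_def t\<^sub>2_def)
      then have "0 \<le> ?a + t\<^sub>1 * ?b" "0 \<le> ?a + t\<^sub>2 * ?b" using h by simp_all
      \<comment> \<open>An affine function that is nonnegative at
        \<open>t\<^sub>1 < 0 < t\<^sub>2\<close> is nonnegative at 0.\<close>
      then have "0 \<le> ?a"
        using sgn mult_nonpos_nonneg[of t\<^sub>1 ?b] mult_nonneg_nonpos[of t\<^sub>2 ?b]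
        by (cases "?b \<ge> 0") linarith+
      then show ?thesis using less by (simp add: \<mu>_def field_simps)
    qed
    then have "f y / g y \<le> \<alpha>" unfolding \<alpha>_def using ne by (intro cInf_greatest) auto
    then show ?thesis using less by (simp add: field_simps)
  qed
  ultimately show ?thesis by blast
qed

lemma qform_line:
  assumes "transpose A = A"
  shows "qform A (y + t *\<^sub>R x) = qform A y + t * (2 * (y \<bullet> (A *v x))) + t\<^sup>2 * qform A x"
  by (simp add: qform_add[OF assms] matrix_vector_mult_scaleR)

text \<open>By compactness the radius \<open>s\<close> can be enlarged without losing the inequality. The enlarged
  radius is positive, which is the Slater condition of the S-lemma, and the excess \<open>s' - s\<close>
  provides the strictness \<open>\<beta>\<close> of the matrix inequality.\<close>

lemma enlarge_radius:
  fixes P :: "real^'n^'n" and F R :: "real^'k^'k" and C :: "real^'n^'k"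
  assumes P: "transpose P = P" and F: "psd F" and R: "psd R" and s: "0 \<le> s"
    and H: "\<And>v w. v \<noteq> 0 \<Longrightarrow> qform R w \<le> s * (v \<bullet> v) \<Longrightarrow> 0 < qform P v - qform F (C *v v + w)"
  obtains s' where "s < s'"
    "\<And>v w. qform R w \<le> s' * (v \<bullet> v) \<Longrightarrow> 0 \<le> qform P v - qform F (C *v v + w)"
proof -
  have symF: "transpose F = F" and nnF: "\<And>v. 0 \<le> qform F v" using F by (auto simp: psd_iff)
  have symR: "transpose R = R" and nnR: "\<And>v. 0 \<le> qform R v" using R by (auto simp: psd_iff)
  \<comment> \<open>A direction in the kernel of \<open>R\<close> can be followed to any length
    within the constraint. If \<open>F\<close> did not vanish on it, the quadratic
    \<open>c - t b - t^2 qform F k\<close> would stay positive for all \<open>t\<close>.\<close>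
  have ker: "F *v k = 0" if k: "R *v k = 0" for k
  proof (rule psd_kernel[OF F], rule ccontr)
    assume "qform F k \<noteq> 0"
    then have pos: "0 < qform F k" using nnF[of k] by simp
    define v :: "real^'n" where "v = axis undefined 1"
    have v: "v \<noteq> 0" by (simp add: v_def axis_eq_0_iff)
    define c where "c = qform P v - qform F (C *v v)"
    define b where "b = 2 * ((C *v v) \<bullet> (F *v k))"
    have line: "0 < c - t * b - t\<^sup>2 * qform F k" for t
    proof -
      have "qform R (t *\<^sub>R k) = 0"
        using k by (simp only: qform_scaleR) (simp add: qform_def)
      then have "0 < qform P v - qform F (C *v v + t *\<^sub>R k)" using s v by (intro H) auto
      then show ?thesis by (simp add: qform_line[OF symF] c_def b_def)
    qed
    \<comment> \<open>At \<open>t\<close> and \<open>- t\<close> the quadratic term cancels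
      \<open>c\<close>, leaving both \<open>- t b > 0\<close> and \<open>t b > 0\<close>.\<close>
    define t where "t = sqrt (c / qform F k)"
    have "0 < c" using line[of 0] by simp
    then have "t\<^sup>2 * qform F k = c" using pos by (simp add: t_def)
    then show False using line[of t] line[of "- t"] by simp
  qed
  obtain J :: "real^'k^'k" where J: "transpose J = J" "J ** J = J" "R ** J = 0" "J ** R = 0"
    "\<And>v. R *v v = 0 \<Longrightarrow> J *v v = v"
    using kernel_projector[OF symR] by blast
  have symRJ: "transpose (R + J) = R + J"
    using symR J(1) by (simp add: transpose_def vec_eq_iff)
  have qRJ: "qform (R + J) w = qform R w + (J *v w) \<bullet> (J *v w)" for w
    using inner_symmetric_matrix[OF J(1), of w "J *v w"]
    by (simp add: qform_def matrix_vector_mult_add_rdistrib inner_add_right matrix_vector_mul_assoc J(2))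
  \<comment> \<open>Coercivity of \<open>R + J\<close> bounds every \<open>w\<close> with
    \<open>J w = 0\<close> in terms of \<open>qform R w\<close>; this makes \<open>D\<close> below
    bounded.\<close>
  have "pd (R + J)"
    unfolding pd_iff
  proof (intro conjI symRJ allI impI)
    fix w :: "real^'k" assume "w \<noteq> 0"
    show "0 < qform (R + J) w"
    proof (cases "J *v w = 0")
      case True
      then have "qform R w \<noteq> 0" using psd_kernel[OF R, of w] J(5)[of w] \<open>w \<noteq> 0\<close> by auto
      then show ?thesis using nnR[of w] by (simp add: qRJ True)
    next
      case False
      then show ?thesis using nnR[of w] by (simp add: qRJ add_nonneg_pos)
    qed
  qed
  then obtain c where c: "0 < c" "\<And>w. c * (w \<bullet> w) \<le> qform (R + J) w"
    using pd_coercive by blast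
  define f where "f p = qform P (fst p) - qform F (C *v fst p + snd p)" for p :: "(real^'n) \<times> (real^'k)"
  \<comment> \<open>The possible violations, normalized by \<open>|v| = 1\<close> and by taking
    \<open>w\<close> orthogonal to the kernel of \<open>R\<close>.\<close>
  define D where "D = {p :: (real^'n) \<times> (real^'k). norm (fst p) = 1 \<and> J *v snd p = 0
    \<and> qform R (snd p) \<le> s + 1 \<and> f p \<le> 0}"
  have contf: "continuous_on UNIV f"
    unfolding f_def
    by (intro continuous_intros bounded_linear.continuous_on[OF matrix_vector_mul_bounded_linear])
  have "closed D"
    unfolding D_def
    by (intro closed_Collect_conj closed_Collect_eq closed_Collect_le contf continuous_intros
        bounded_linear.continuous_on[OF matrix_vector_mul_bounded_linear])
  moreover have "bounded D"
  proof (rule bounded_subset)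
    show "bounded (sphere (0 :: real^'n) 1 \<times> cball (0 :: real^'k) (sqrt ((s + 1) / c)))"
      by (intro bounded_Times bounded_sphere bounded_cball)
    show "D \<subseteq> sphere 0 1 \<times> cball 0 (sqrt ((s + 1) / c))"
    proof
      fix p assume p: "p \<in> D"
      then have "c * (snd p \<bullet> snd p) \<le> s + 1"
        using c(2)[of "snd p"] by (simp add: D_def qRJ)
      then have "(norm (snd p))\<^sup>2 \<le> (s + 1) / c"
        using c(1) by (simp add: power2_norm_eq_inner field_simps)
      then have "norm (snd p) \<le> sqrt ((s + 1) / c)" by (rule real_le_rsqrt)
      then show "p \<in> sphere 0 1 \<times> cball 0 (sqrt ((s + 1) / c))"
        using p by (simp add: D_def mem_Times_iff)
    qed
  qed
  ultimately have comp: "compact D" by (simp add: compact_eq_bounded_closed)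
  \<comment> \<open>By \<open>H\<close>, the minimum of \<open>qform R\<close> over the compact set
    \<open>D\<close> exceeds \<open>s\<close>, so a radius strictly in between avoids all
    violations.\<close>
  obtain s' where s': "s < s'" "s' \<le> s + 1" "\<And>p. p \<in> D \<Longrightarrow> s' < qform R (snd p)"
  proof (cases "D = {}")
    case True
    then show ?thesis using that[of "s + 1"] by simp
  next
    case False
    have "continuous_on D (\<lambda>p. qform R (snd p))" by (intro continuous_intros)
    then obtain p where p: "p \<in> D" "\<And>q. q \<in> D \<Longrightarrow> qform R (snd p) \<le> qform R (snd q)"
      using continuous_attains_inf[OF comp False] by blast
    have "s < qform R (snd p)"
    proof (rule ccontr)
      assume "\<not> s < qform R (snd p)"
      then have "0 < f p"
        unfolding f_def using p(1) by (intro H) (auto simp: D_def power2_norm_eq_inner[symmetric])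
      then show False using p(1) by (simp add: D_def)
    qed
    then show ?thesis
      using that[of "(s + min (s + 1) (qform R (snd p))) / 2"] p(2) by fastforce
  qed
  have unit: "0 < qform P v - qform F (C *v v + w)"
    if "norm v = 1" "J *v w = 0" "qform R w \<le> s'" for v w
    by (rule ccontr) (use s'(2) s'(3)[of "(v, w)"] that in \<open>auto simp: D_def f_def\<close>)
  have "0 \<le> qform P v - qform F (C *v v + w)" if w: "qform R w \<le> s' * (v \<bullet> v)" for v w
  proof (cases "v = 0")
    case True
    \<comment> \<open>For \<open>v = 0\<close> the constraint forces \<open>w\<close> into the
      kernel of \<open>R\<close>, hence of \<open>F\<close>.\<close>
    then have "F *v w = 0" using w nnR[of w] psd_kernel[OF R, of w] ker by simp
    then show ?thesis by (simp add: True qform_def)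
  next
    case False
    \<comment> \<open>The removed component lies in the kernels of both \<open>R\<close> and
      \<open>F\<close>, so neither form changes.\<close>
    define w\<^sub>0 where "w\<^sub>0 = w - J *v w"
    have RJ: "R *v (J *v w) = 0" and JJ: "J *v (J *v w) = J *v w"
      by (simp_all add: matrix_vector_mul_assoc J)
    have FJ: "F *v (J *v w) = 0" by (rule ker) (rule RJ)
    have R0: "qform R w\<^sub>0 = qform R w"
      by (simp add: w\<^sub>0_def qform_diff[OF symR] RJ) (simp add: qform_def RJ)
    have "qform F ((C *v v + w) - J *v w) = qform F (C *v v + w)"
      by (simp only: qform_diff[OF symF] FJ) (simp add: qform_def FJ)
    then have F0: "qform F (C *v v + w\<^sub>0) = qform F (C *v v + w)" by (simp add: w\<^sub>0_def algebra_simps)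
    define t where "t = 1 / norm v"
    have t: "t > 0" "t\<^sup>2 * (v \<bullet> v) = 1"
      using False by (simp_all add: t_def power_divide power2_norm_eq_inner)
    have "0 < qform P (t *\<^sub>R v) - qform F (C *v (t *\<^sub>R v) + t *\<^sub>R w\<^sub>0)"
    proof (rule unit)
      show "norm (t *\<^sub>R v) = 1" using False by (simp add: t_def)
      show "J *v (t *\<^sub>R w\<^sub>0) = 0"
        by (simp add: matrix_vector_mult_scaleR w\<^sub>0_def matrix_vector_mult_diff_distrib JJ)
      show "qform R (t *\<^sub>R w\<^sub>0) \<le> s'"
        using mult_left_mono[OF w, of "t\<^sup>2"] t by (simp add: R0 mult.left_commute)
    qed
    also have "C *v (t *\<^sub>R v) + t *\<^sub>R w\<^sub>0 = t *\<^sub>R (C *v v + w\<^sub>0)"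
      by (simp add: matrix_vector_mult_scaleR scaleR_add_right)
    also have "qform P (t *\<^sub>R v) - qform F \<dots> = t\<^sup>2 * (qform P v - qform F (C *v v + w))"
      by (simp add: F0 right_diff_distrib)
    finally show ?thesis using t(1) by (simp add: zero_less_mult_iff)
  qed
  with s'(1) show ?thesis by (rule that)
qed

text \<open>The S-lemma on pairs \<open>(v, w)\<close>; \<open>f'\<close> and \<open>g'\<close> are
  the cross terms. A unit vector paired with 0 is the Slater point, since \<open>s' > s\<close> and
  \<open>s\<close> is nonnegative.\<close>

lemma robust_multiplier:
  fixes P :: "real^'n^'n" and F R :: "real^'k^'k" and C :: "real^'n^'k"
  assumes P: "transpose P = P" and F: "psd F" and R: "psd R" and s: "0 \<le> s"
    and H: "\<And>v w. v \<noteq> 0 \<Longrightarrow> qform R w \<le> s * (v \<bullet> v) \<Longrightarrow> 0 < qform P v - qform F (C *v v + w)"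
  obtains \<alpha> s' where "0 \<le> \<alpha>" "s < s'"
    "\<And>v w. \<alpha> * (s' * (v \<bullet> v) - qform R w) \<le> qform P v - qform F (C *v v + w)"
proof -
  have symF: "transpose F = F" and symR: "transpose R = R" using F R by (auto simp: psd_iff)
  obtain s' where s': "s < s'"
    "\<And>v w. qform R w \<le> s' * (v \<bullet> v) \<Longrightarrow> 0 \<le> qform P v - qform F (C *v v + w)"
    using enlarge_radius[OF P F R s H] by blast
  define f where "f p = qform P (fst p) - qform F (C *v fst p + snd p)" for p :: "(real^'n) \<times> (real^'k)"
  define g where "g p = s' * (fst p \<bullet> fst p) - qform R (snd p)" for p :: "(real^'n) \<times> (real^'k)"
  define f' where "f' x y = 2 * (fst y \<bullet> (P *v fst x))
      - 2 * ((C *v fst y + snd y) \<bullet> (F *v (C *v fst x + snd x)))"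
    for x y :: "(real^'n) \<times> (real^'k)"
  define g' where "g' x y = s' * (2 * (fst y \<bullet> fst x)) - 2 * (snd y \<bullet> (R *v snd x))"
    for x y :: "(real^'n) \<times> (real^'k)"
  have "f (y + t *\<^sub>R x) = f y + t * f' x y + t\<^sup>2 * f x" for x y t
  proof -
    have "C *v fst (y + t *\<^sub>R x) + snd (y + t *\<^sub>R x)
        = (C *v fst y + snd y) + t *\<^sub>R (C *v fst x + snd x)"
      by (simp add: matrix_vector_right_distrib matrix_vector_mult_scaleR scaleR_add_right)
    then have "f (y + t *\<^sub>R x) = qform P (fst y + t *\<^sub>R fst x)
        - qform F ((C *v fst y + snd y) + t *\<^sub>R (C *v fst x + snd x))"
      unfolding f_def by (simp only:) simp
    then show ?thesis
      unfolding qform_line[OF P] qform_line[OF symF] by (simp add: f_def f'_def algebra_simps)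
  qed
  moreover have "g (y + t *\<^sub>R x) = g y + t * g' x y + t\<^sup>2 * g x" for x y t
    by (simp add: g_def g'_def qform_line[OF symR] inner_add inner_commute power2_eq_square
        algebra_simps)
  moreover have "0 \<le> f p" if "0 \<le> g p" for p using s'(2) that by (simp add: f_def g_def)
  moreover have "0 < g (axis undefined 1, 0)"
    using s s'(1) by (simp add: g_def inner_axis_axis)
  ultimately have "\<exists>\<alpha>\<ge>0. \<forall>p. \<alpha> * g p \<le> f p" by (rule S_lemma)
  then obtain \<alpha> where \<alpha>: "0 \<le> \<alpha>" "\<And>p. \<alpha> * g p \<le> f p" by blast
  show ?thesis
  proof (rule that)
    show "\<alpha> * (s' * (v \<bullet> v) - qform R w) \<le> qform P v - qform F (C *v v + w)" for v w
      using \<alpha>(2)[of "(v, w)"] by (simp add: f_def g_def)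
  qed (fact \<alpha>(1) s'(1))+
qed

text \<open>Let \<open>w\<close> be the vector on the left. Subtracting
  \<open>(v $ i / |v|^2) w\<close> from each row leaves nonnegative forms, whose sum is the original
  sum minus \<open>qform R w / |v|^2\<close>.\<close>

lemma qform_transpose_mult_le:
  fixes R :: "real^'k^'k" and \<Delta> :: "real^'k^'n"
  assumes R: "psd R"
  shows "qform R (transpose \<Delta> *v v) \<le> (v \<bullet> v) * (\<Sum>i\<in>UNIV. qform R (\<Delta> $ i))"
proof (cases "v = 0")
  case False
  have symR: "transpose R = R" and nnR: "\<And>v. 0 \<le> qform R v" using R by (auto simp: psd_iff)
  define w where "w = transpose \<Delta> *v v"
  have w: "w = (\<Sum>i\<in>UNIV. v $ i *\<^sub>R (\<Delta> $ i))"
    by (simp add: w_def matrix_vector_mult_def transpose_def vec_eq_iff mult.commute)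
  define t where "t = 1 / (v \<bullet> v)"
  have vv: "0 < v \<bullet> v" using False by simp
  have vv2: "v \<bullet> v = (\<Sum>i\<in>UNIV. (v $ i)\<^sup>2)" by (simp add: inner_vec_def power2_eq_square)
  have "0 \<le> (\<Sum>i\<in>UNIV. qform R (\<Delta> $ i - (t * v $ i) *\<^sub>R w))" by (intro sum_nonneg nnR)
  also have "\<dots> = (\<Sum>i\<in>UNIV. qform R (\<Delta> $ i) - 2 * t * ((v $ i *\<^sub>R (\<Delta> $ i)) \<bullet> (R *v w))
      + t\<^sup>2 * qform R w * (v $ i)\<^sup>2)"
    by (intro sum.cong refl)
       (simp add: qform_diff[OF symR] matrix_vector_mult_scaleR power_mult_distrib)
  also have "\<dots> = (\<Sum>i\<in>UNIV. qform R (\<Delta> $ i)) - 2 * t * (w \<bullet> (R *v w)) + t\<^sup>2 * qform R w * (v \<bullet> v)"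
    unfolding sum.distrib sum_subtractf vv2 sum_distrib_left[symmetric] w inner_sum_left ..
  also have "\<dots> = (\<Sum>i\<in>UNIV. qform R (\<Delta> $ i)) - t * qform R w"
    using vv by (simp add: qform_def[symmetric] t_def power2_eq_square)
  finally show ?thesis using vv by (simp add: t_def w_def[symmetric] field_simps)
qed simp

text \<open>The matrix \<open>v w^T / |v|^2\<close> attains equality in
  \<open>qform_transpose_mult_le\<close>, for every \<open>R\<close> at once.\<close>

lemma rank_one_perturbation:
  fixes v :: "real^'n" and w :: "real^'k"
  assumes "v \<noteq> 0"
  obtains \<Delta> :: "real^'k^'n" where "transpose \<Delta> *v v = w"
    "\<And>R. (\<Sum>i\<in>UNIV. qform R (\<Delta> $ i)) = qform R w / (v \<bullet> v)"
proof
  define \<Delta> :: "real^'k^'n" where "\<Delta> = (\<chi> i. (v $ i / (v \<bullet> v)) *\<^sub>R w)"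
  have vv: "v \<bullet> v \<noteq> 0" using assms by simp
  have vv2: "(\<Sum>i\<in>UNIV. v $ i * v $ i) = v \<bullet> v" by (simp add: inner_vec_def)
  have "(transpose \<Delta> *v v) $ j = w $ j" for j
  proof -
    have "(transpose \<Delta> *v v) $ j = (\<Sum>i\<in>UNIV. v $ i * v $ i) * (w $ j / (v \<bullet> v))"
      by (simp add: \<Delta>_def matrix_vector_mult_def transpose_def sum_distrib_right sum_distrib_left
          sum_divide_distrib
          mult.commute mult.left_commute)
    then show ?thesis using vv unfolding vv2 by simp
  qed
  then show "transpose \<Delta> *v v = w" by (simp add: vec_eq_iff)
  show "(\<Sum>i\<in>UNIV. qform R (\<Delta> $ i)) = qform R w / (v \<bullet> v)" for R
  proof -
    have "(\<Sum>i\<in>UNIV. qform R (\<Delta> $ i)) = (\<Sum>i\<in>UNIV. v $ i * v $ i) * (qform R w / (v \<bullet> v)\<^sup>2)"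
      by (simp add: \<Delta>_def power_divide power2_eq_square sum_distrib_right
          sum_divide_distrib)
    then show ?thesis using vv unfolding vv2 by (simp add: power2_eq_square)
  qed
qed

section \<open>Block matrices and Kronecker products\<close>

definition vjoin :: "real^'a \<Rightarrow> real^'b \<Rightarrow> real^('a + 'b)" where
  "vjoin v w = (\<chi> i. case i of Inl k \<Rightarrow> v $ k | Inr k \<Rightarrow> w $ k)"

lemma vjoin_nth [simp]: "vjoin v w $ Inl i = v $ i" "vjoin v w $ Inr j = w $ j"
  by (simp_all add: vjoin_def)

lemma vjoin_cases:
  fixes x :: "real^('a::finite + 'b::finite)"
  obtains v w where "x = vjoin v w"
proof
  show "x = vjoin (\<chi> i. x $ Inl i) (\<chi> i. x $ Inr i)"
    by (auto simp: vjoin_def vec_eq_iff split: sum.split)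
qed

lemma sum_UNIV_sum:
  "(\<Sum>i\<in>UNIV. g i) = (\<Sum>i\<in>UNIV. g (Inl i)) + (\<Sum>j\<in>UNIV. g (Inr j))"
  for g :: "'a::finite + 'b::finite \<Rightarrow> 'c::comm_monoid_add"
  by (simp add: UNIV_Plus_UNIV[symmetric] sum.Plus del: UNIV_Plus_UNIV)

lemma inner_vjoin [simp]: "vjoin a b \<bullet> vjoin c d = a \<bullet> c + b \<bullet> d"
  by (simp add: inner_vec_def sum_UNIV_sum)

lemma vcat_mult_vector: "vcat A B *v x = vjoin (A *v x) (B *v x)"
  by (auto simp: vcat_def vjoin_def matrix_vector_mult_def vec_eq_iff split: sum.split)

lemma hcat_mult_vjoin: "hcat A B *v vjoin v w = A *v v + B *v w"
  by (simp add: hcat_def matrix_vector_mult_def vec_eq_iff sum_UNIV_sum)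

lemma transpose_hcat: "transpose (hcat A B) = vcat (transpose A) (transpose B)"
  by (auto simp: hcat_def vcat_def transpose_def vec_eq_iff split: sum.split)

lemma transpose_vcat: "transpose (vcat A B) = hcat (transpose A) (transpose B)"
  by (auto simp: hcat_def vcat_def transpose_def vec_eq_iff split: sum.split)

lemma hcat_mult_vcat: "hcat A B ** vcat C D = A ** C + B ** D"
  by (simp add: hcat_def vcat_def matrix_matrix_mult_def vec_eq_iff sum_UNIV_sum)

lemma block_mult_vjoin:
  "block A B C D *v vjoin v w = vjoin (A *v v + B *v w) (C *v v + D *v w)"
  by (simp add: block_def vcat_mult_vector hcat_mult_vjoin)

lemma block_mult_block:
  "block A B C D ** block A' B' C' D'
     = block (A ** A' + B ** C') (A ** B' + B ** D') (C ** A' + D ** C') (C ** B' + D ** D')"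
  by (auto simp: block_def vcat_def hcat_def matrix_matrix_mult_def vec_eq_iff sum_UNIV_sum
      split: sum.split)

lemma block_blocks: "block (block11 A) (block12 A) (block21 A) (block22 A) = A"
  by (auto simp: block_def vcat_def hcat_def block11_def block12_def block21_def block22_def
      vec_eq_iff split: sum.split)

lemma block21_symmetric:
  assumes "transpose A = A"
  shows "block21 A = transpose (block12 A)"
proof -
  have "A $ i $ j = A $ j $ i" for i j using arg_cong[OF assms, of "\<lambda>M. M $ j $ i"]
    by (simp add: transpose_def)
  then show ?thesis by (simp add: block21_def block12_def transpose_def vec_eq_iff)
qed

lemma qform_block:
  "qform (block A B C D) (vjoin v w) = qform A v + v \<bullet> (B *v w) + w \<bullet> (C *v v) + qform D w"
  by (simp add: qform_def block_mult_vjoin inner_add_right)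

lemma qform_block_symmetric:
  "qform (block A B (transpose B) D) (vjoin v w) = qform A v + 2 * (w \<bullet> (transpose B *v v)) + qform D w"
  using inner_transpose_matrix[of v B w] by (simp add: qform_block inner_commute)

lemma one_vec_vjoin: "one_vec w = vjoin 1 w"
  by (auto simp: one_vec_def vjoin_def vec_eq_iff split: sum.split)

text \<open>With \<open>C = - (Q\<^sub>1\<^sub>2 S\<^sup>\<dagger>)\<^sup>T\<close> the quadratic form of \<open>Q\<close> becomes
  \<open>s \<bar>v\<bar>\<^sup>2 + (y - C v)\<^sup>T S (y - C v)\<close>: the data-compatible systems form
  a ball centred at \<open>C\<^sup>T\<close>.\<close>

lemma
  fixes S :: "real^'k^'k" and Q\<^sub>1\<^sub>2 :: "real^'k^'n"
  assumes S: "transpose S = S" and ker: "\<And>k. S *v k = 0 \<Longrightarrow> Q\<^sub>1\<^sub>2 *v k = 0"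
    and C: "C = - transpose (Q\<^sub>1\<^sub>2 ** pinv S)"
  shows center_eq: "S *v (C *v v) = - (transpose Q\<^sub>1\<^sub>2 *v v)"
    and qform_center: "qform (Q\<^sub>1\<^sub>2 ** pinv S ** transpose Q\<^sub>1\<^sub>2) v = qform S (C *v v)"
    and complete_square: "qform (block (s *\<^sub>R mat 1 + Q\<^sub>1\<^sub>2 ** pinv S ** transpose Q\<^sub>1\<^sub>2) Q\<^sub>1\<^sub>2 (transpose Q\<^sub>1\<^sub>2) S)
      (vjoin v y) = s * (v \<bullet> v) + qform S (y - C *v v)"
proof -
  have G: "is_pinv S (pinv S)" by (intro is_pinv_pinv ex_is_pinv_symmetric S)
  \<comment> \<open>The difference lies in the kernel of \<open>S\<close> because
    \<open>S S\<^sup>\<dagger> S = S\<close>; the kernel inclusion then yields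
    \<open>Q\<^sub>1\<^sub>2 S\<^sup>\<dagger> S = Q\<^sub>1\<^sub>2\<close>.\<close>
  have "Q\<^sub>1\<^sub>2 *v (pinv S *v (S *v k) - k) = 0" for k
    using G by (intro ker) (simp add: is_pinv_def matrix_vector_mult_diff_distrib
        matrix_vector_mul_assoc matrix_mul_assoc)
  then have "Q\<^sub>1\<^sub>2 ** pinv S ** S = Q\<^sub>1\<^sub>2"
    by (subst matrix_eq) (simp add: matrix_vector_mult_diff_distrib matrix_vector_mul_assoc matrix_mul_assoc)
  then have "transpose (Q\<^sub>1\<^sub>2 ** pinv S ** S) = transpose Q\<^sub>1\<^sub>2" by simp
  then have SC: "S ** transpose (Q\<^sub>1\<^sub>2 ** pinv S) = transpose Q\<^sub>1\<^sub>2"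
    by (simp add: matrix_transpose_mul[of "Q\<^sub>1\<^sub>2 ** pinv S"] S)
  show eq: "S *v (C *v v) = - (transpose Q\<^sub>1\<^sub>2 *v v)" for v
    unfolding C by (simp add: matrix_vector_mult_uminus_left matrix_vector_mult_uminus_right
        matrix_vector_mul_assoc SC)
  show qc: "qform (Q\<^sub>1\<^sub>2 ** pinv S ** transpose Q\<^sub>1\<^sub>2) v = qform S (C *v v)" for v
  proof -
    have "qform (Q\<^sub>1\<^sub>2 ** pinv S ** transpose Q\<^sub>1\<^sub>2) v = v \<bullet> ((Q\<^sub>1\<^sub>2 ** pinv S) *v (transpose Q\<^sub>1\<^sub>2 *v v))"
      by (simp add: qform_def matrix_vector_mul_assoc)
    also have "\<dots> = (transpose (Q\<^sub>1\<^sub>2 ** pinv S) *v v) \<bullet> (transpose Q\<^sub>1\<^sub>2 *v v)"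
      by (rule inner_transpose_matrix)
    also have "\<dots> = qform S (C *v v)"
      by (simp only: qform_def eq) (simp add: C matrix_vector_mult_uminus_left)
    finally show ?thesis .
  qed
  have "qform (s *\<^sub>R mat 1 + Q\<^sub>1\<^sub>2 ** pinv S ** transpose Q\<^sub>1\<^sub>2) v = s * (v \<bullet> v) + qform S (C *v v)"
    unfolding qc[symmetric]
    by (simp add: qform_def matrix_vector_mult_add_rdistrib inner_add_right scaleR_matrix_vector_assoc[symmetric])
  then show "qform (block (s *\<^sub>R mat 1 + Q\<^sub>1\<^sub>2 ** pinv S ** transpose Q\<^sub>1\<^sub>2) Q\<^sub>1\<^sub>2 (transpose Q\<^sub>1\<^sub>2) S)
      (vjoin v y) = s * (v \<bullet> v) + qform S (y - C *v v)"
    by (simp add: qform_block_symmetric qform_diff[OF S] eq)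
qed

section \<open>Kronecker products with the identity, acting on vectorized matrices\<close>

lemma transpose_kron: "transpose (kron A B) = kron (transpose A) (transpose B)"
  by (simp add: transpose_def kron_def vec_eq_iff)

lemma sum_UNIV_prod:
  "(\<Sum>p\<in>UNIV. g p) = (\<Sum>i\<in>UNIV. \<Sum>j\<in>UNIV. g (i, j))"
  for g :: "'a::finite \<times> 'b::finite \<Rightarrow> 'c::comm_monoid_add"
  by (simp add: sum.cartesian_product flip: UNIV_Times_UNIV)

lemma kron_mult: "kron A B ** kron C D = kron (A ** C) (B ** D)"
proof -
  have "(kron A B ** kron C D) $ r $ c = kron (A ** C) (B ** D) $ r $ c" for r c
    unfolding kron_def matrix_matrix_mult_def
    by (simp only: vec_lambda_beta sum_UNIV_prod sum_product fst_conv snd_conv)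
       (intro sum.cong refl, simp)
  then show ?thesis by (subst vec_eq_iff) (simp add: vec_eq_iff)
qed

lemma kron_mat1_vectorize: "kron S (mat 1) *v vectorize Z = vectorize (Z ** transpose S)"
proof -
  have "(kron S (mat 1) *v vectorize Z) $ (j, i) = vectorize (Z ** transpose S) $ (j, i)" for i j
  proof -
    have "(kron S (mat 1) *v vectorize Z) $ (j, i)
        = (\<Sum>k\<in>UNIV. \<Sum>l\<in>UNIV. if i = l then S $ j $ k * Z $ l $ k else 0)"
      unfolding kron_def matrix_vector_mult_def vectorize_def
      by (simp only: vec_lambda_beta sum_UNIV_prod fst_conv snd_conv)
         (intro sum.cong refl, simp add: mat_def)
    also have "\<dots> = (\<Sum>k\<in>UNIV. Z $ i $ k * S $ j $ k)"
      by (intro sum.cong refl) (simp add: mult.commute)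
    finally show ?thesis by (simp add: vectorize_def matrix_matrix_mult_def transpose_def)
  qed
  then show ?thesis by (simp add: vec_eq_iff split_paired_all)
qed

text \<open>By uniqueness this determines the pseudoinverse of the lower right block of
  \<open>N\<close>.\<close>

lemma is_pinv_kron:
  assumes "is_pinv A G"
  shows "is_pinv (kron A (mat 1)) (kron G (mat 1))"
  using assms by (simp add: is_pinv_def kron_mult transpose_kron)

lemma inner_vectorize: "vectorize Y \<bullet> vectorize Z = (\<Sum>i\<in>UNIV. Y $ i \<bullet> Z $ i)"
  by (simp add: vectorize_def inner_vec_def sum_UNIV_prod) (rule sum.swap)

lemma row_mult_transpose: "(Z ** transpose S) $ i = S *v (Z $ i)" for S :: "real^'a^'b"
  by (simp add: matrix_vector_mult_def matrix_matrix_mult_def transpose_def vec_eq_iff)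
     (simp add: mult.commute)

text \<open>The Kronecker product applies \<open>S\<close> to each row separately; the sum is
  \<open>tr (Z S Z^T)\<close>.\<close>

lemma qform_kron: "qform (kron S (mat 1)) (vectorize Z) = (\<Sum>i\<in>UNIV. qform S (Z $ i))"
  by (simp add: qform_def kron_mat1_vectorize inner_vectorize row_mult_transpose)

lemma vectorize_diff: "vectorize (Y - Z) = vectorize Y - vectorize Z"
  by (simp add: vectorize_def vec_eq_iff)

lemma columnvector_mult_1: "columnvector w *v (1 :: real^1) = w"
  by (simp add: columnvector_def matrix_vector_mult_def vec_eq_iff)

text \<open>\<open>E\<close> sends a system to its residual, the one noise matrix with which it
  explains the data. Hence the form of \<open>N\<close> at \<open>[A B]\<close> is the form of
  \<Phi> at that residual.\<close>

lemma E_mat_one_vec: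
  fixes x :: "nat \<Rightarrow> real^'n" and u :: "nat \<Rightarrow> real^'m"
  shows "(E_mat u x :: real^(1 + ('n + 'm) \<times> 'n)^(1 + 't::{finite, linorder} \<times> 'n)) *v one_vec (vectorize (hcat A B))
    = one_vec (vectorize (X_plus x - (A ** X_minus x + B ** U_minus u)))"
  by (simp add: E_mat_def one_vec_vjoin block_mult_vjoin columnvector_mult_1
      matrix_vector_mult_uminus_left kron_mat1_vectorize vectorize_diff hcat_mult_vcat)

lemma congruence_block:
  fixes c :: "real^'a^'b" and K :: "real^'d^'b" and A :: "real^('a + 'b)^('a + 'b)"
  defines "M \<equiv> transpose (block (mat 1) 0 c K) ** A ** block (mat 1) 0 c K"
  shows "block22 M = transpose K ** block22 A ** K"
    and "block12 M = (block12 A + transpose c ** block22 A) ** K"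
proof -
  have "M = transpose (block (mat 1) 0 c K) ** block (block11 A) (block12 A) (block21 A) (block22 A)
      ** block (mat 1) 0 c K"
    by (simp only: M_def block_blocks)
  then show "block22 M = transpose K ** block22 A ** K"
    and "block12 M = (block12 A + transpose c ** block22 A) ** K"
    by (simp_all add: transpose_block transpose_0 block_mult_block)
qed

lemma matrix_mult_uminus_left: "(- A) ** B = - (A ** B)" for A :: "real^'a^'b"
  by (simp add: matrix_matrix_mult_def vec_eq_iff sum_negf)

lemma matrix_mult_uminus_right: "A ** (- B) = - (A ** B)" for A :: "real^'a^'b"
  by (simp add: matrix_matrix_mult_def vec_eq_iff sum_negf)

lemma transpose_nth: "transpose C $ i = C *v axis i 1" for C :: "real^'a^'b"
  by (simp add: matrix_vector_mult_basis column_def transpose_def vec_eq_iff)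

lemma qform_1: "qform M (1 :: real^1) = M $ 1 $ 1"
  by (simp add: qform_def inner_vec_def matrix_vector_mult_def)

section \<open>Lyapunov inequalities and the matrix inequality\<close>

lemma transpose_add: "transpose (A + B) = transpose A + transpose (B :: real^'a^'b)"
  by (simp add: transpose_def vec_eq_iff)

lemma transpose_diff: "transpose (A - B) = transpose A - transpose (B :: real^'a^'b)"
  by (simp add: transpose_def vec_eq_iff)

lemma pd_invertible:
  assumes "pd P"
  shows "P ** matrix_inv P = mat 1" "matrix_inv P ** P = mat 1"
proof -
  have "v = 0" if "P *v v = 0" for v
    using assms that by (cases "v = 0") (auto simp: pd_def)
  then have "invertible P"
    unfolding invertible_left_inverse by (simp add: matrix_left_invertible_ker)
  then show "P ** matrix_inv P = mat 1" "matrix_inv P ** P = mat 1"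
    unfolding invertible_def matrix_inv_def by (metis (mono_tags, lifting) someI_ex)+
qed

text \<open>The lower right block is \<open>- [I; K] P [I; K]^T\<close>. At
  \<open>a = A^T v\<close>, \<open>b = B^T v\<close> the last argument is
  \<open>(A + B K)^T v\<close>.\<close>

lemma qform_M_stab:
  assumes P: "transpose P = P"
  shows "qform (M_stab (P, K)) (vjoin v (vjoin a b)) = qform P v - qform P (a + transpose K *v b)"
proof -
  have "qform P (a + transpose K *v b)
      = qform P a + a \<bullet> (P *v (transpose K *v b)) + b \<bullet> (K *v (P *v a)) + b \<bullet> (K *v (P *v (transpose K *v b)))"
    using inner_symmetric_matrix[OF P, of a "transpose K *v b"]
    by (simp add: qform_add[OF P] inner_transpose_matrix[of b K] inner_commute)
       (simp add: qform_def inner_transpose_matrix[of b K] matrix_mul_assoc)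
  then show ?thesis
    by (simp add: M_stab_def qform_block matrix_vector_mult_uminus_left matrix_vector_mul_assoc)
       (simp add: qform_def matrix_vector_mul_assoc matrix_mul_assoc)
qed

text \<open>The inequality replaces the block \<open>- K P K^T\<close> by 0 to stay linear in
  \<open>P\<close> and \<open>L\<close>. The variable \<open>c\<close> restores it by a completed
  square: \<open>qform P (c + k) - qform P k\<close> collects all terms in \<open>c\<close>.\<close>

lemma qform_LMI:
  assumes P: "transpose P = P" and L: "L = K ** P" and k: "k = transpose K *v b"
  shows "qform (block
       (block (P - \<beta> *\<^sub>R mat 1) 0 0 (block (- P) (- transpose L) (- L) 0))
       (vcat 0 (vcat 0 L)) (hcat 0 (hcat 0 (transpose L))) P
     - block Q 0 0 0) (vjoin (vjoin v (vjoin a b)) c)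
    = qform P v - \<beta> * (v \<bullet> v) - qform P (a + k) + qform P (c + k) - qform Q (vjoin v (vjoin a b))"
proof -
  have sub: "qform (A - B) z = qform A z - qform B z" for A B :: "real^'z^'z" and z
    by (simp add: qform_def matrix_vector_mult_diff_rdistrib inner_diff_right)
  have L1: "b \<bullet> (L *v d) = d \<bullet> (P *v k)" for d
    using inner_transpose_matrix[of b K "P *v d"] inner_symmetric_matrix[OF P, of k d]
    by (simp add: L k matrix_vector_mul_assoc[symmetric] inner_commute)
  have L2: "d \<bullet> (transpose L *v b) = d \<bullet> (P *v k)" for d
    using L1[of d] inner_transpose_matrix[of d "transpose L" b] by (simp add: inner_commute)
  show ?thesis
    by (simp add: sub qform_block vcat_mult_vector hcat_mult_vjoin matrix_vector_mult_uminus_left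
        L1 L2 qform_add[OF P])
       (simp add: qform_def scaleR_matrix_vector_assoc[symmetric])
qed

lemma transpose_LMI:
  assumes P: "transpose P = P" and Q: "transpose Q = Q"
  shows "transpose (block
       (block (P - \<beta> *\<^sub>R mat 1) 0 0 (block (- P) (- transpose L) (- L) 0))
       (vcat 0 (vcat 0 L)) (hcat 0 (hcat 0 (transpose L))) P
     - block Q 0 0 0) = block
       (block (P - \<beta> *\<^sub>R mat 1) 0 0 (block (- P) (- transpose L) (- L) 0))
       (vcat 0 (vcat 0 L)) (hcat 0 (hcat 0 (transpose L))) P
     - block Q 0 0 0"
proof -
  have "transpose (P - \<beta> *\<^sub>R mat 1) = P - \<beta> *\<^sub>R mat 1"
    using P by (simp add: transpose_def vec_eq_iff mat_def)
  then show ?thesis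
    by (simp add: transpose_diff transpose_block transpose_uminus transpose_0 transpose_hcat
        transpose_vcat P Q)
qed

text \<open>The Lyapunov inequality \<open>P - C P C\<^sup>T > 0\<close> is transferred to \<open>P\<^sup>-\<^sup>1 - C\<^sup>T P\<^sup>-\<^sup>1 C > 0\<close>,
  whose form can be evaluated at right eigenvectors of \<open>C\<close>.\<close>

lemma schur_stable_if_lyapunov:
  fixes P C :: "real^'n^'n"
  assumes P: "pd P" and dec: "\<And>v. v \<noteq> 0 \<Longrightarrow> qform P (transpose C *v v) < qform P v"
  shows "schur_stable C"
proof -
  have sym: "transpose P = P" and pos: "\<And>v. v \<noteq> 0 \<Longrightarrow> 0 < qform P v"
    using P by (auto simp: pd_iff)
  define D where "D = matrix_inv P"
  have PD: "P *v (D *v v) = v" for v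
    using pd_invertible[OF P] by (simp add: D_def matrix_vector_mul_assoc)
  \<comment> \<open>This is the inverse of \<open>P\<close>, written as a congruence so that its
    values are values of \<open>P\<close>.\<close>
  define R where "R = transpose D ** P ** D"
  have symR: "transpose R = R" by (simp add: R_def matrix_transpose_mul sym matrix_mul_assoc)
  have R: "qform R v = qform P (D *v v)" for v unfolding R_def by (rule qform_congruence)
  have D0: "D *v v \<noteq> 0" if "v \<noteq> 0" for v using PD[of v] that by auto
  have posR: "0 < qform R v" if "v \<noteq> 0" for v using D0[OF that] by (simp add: R pos)
  have decR: "qform R (C *v v) < qform R v" if v: "v \<noteq> 0" for v
  proof (cases "C *v v = 0")
    case True
    then show ?thesis using posR[OF v] by simp
  next
    case False
    \<comment> \<open>Expanding \<open>qform P (p - D v)\<close> gives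
      \<open>2 qform P z <= qform P p + qform P (D v)\<close>, while \<open>dec\<close> bounds
      \<open>qform P p\<close> by \<open>qform P z\<close>.\<close>
    define z where "z = D *v (C *v v)"
    define p where "p = transpose C *v z"
    have "p \<bullet> (P *v (D *v v)) = qform P z"
      using inner_transpose_matrix[of z C v] by (simp add: PD p_def qform_def z_def)
    moreover have "0 \<le> qform P (p - D *v v)"
      using pd_imp_psd[OF P] by (simp add: psd_iff)
    moreover have "qform P p < qform P z"
      unfolding p_def using D0[OF False] by (intro dec) (simp add: z_def)
    ultimately have "qform P z < qform P (D *v v)"
      by (simp add: qform_diff[OF sym])
    then show ?thesis by (simp add: R z_def)
  qed
  show ?thesis
    unfolding schur_stable_def
  proof (intro allI impI, elim conjE)
    fix c :: complex and v :: "complex^'n"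
    assume v: "v \<noteq> 0" and eig: "map_matrix complex_of_real C *v v = c *s v"
    define a b :: "real^'n" where "a = (\<chi> i. Re (v $ i))" and "b = (\<chi> i. Im (v $ i))"
    have comp: "(\<Sum>j\<in>UNIV. complex_of_real (C $ i $ j) * v $ j) = c * v $ i" for i
      using arg_cong[OF eig, of "\<lambda>w. w $ i"]
      by (simp add: matrix_vector_mult_def map_matrix_def)
    have Ca: "C *v a = Re c *\<^sub>R a - Im c *\<^sub>R b"
      using arg_cong[OF comp, of Re] by (simp add: a_def b_def matrix_vector_mult_def vec_eq_iff)
    have Cb: "C *v b = Im c *\<^sub>R a + Re c *\<^sub>R b"
      using arg_cong[OF comp, of Im]
      by (simp add: a_def b_def matrix_vector_mult_def vec_eq_iff algebra_simps)
    have ab: "a \<noteq> 0 \<or> b \<noteq> 0"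
      using v by (auto simp: a_def b_def vec_eq_iff complex_eq_iff)
    \<comment> \<open>On real and imaginary parts \<open>c\<close> acts as a rotation scaled by
      \<open>|c|\<close>, so the cross terms cancel in the sum.\<close>
    have eq: "qform R (C *v a) + qform R (C *v b) = (cmod c)\<^sup>2 * (qform R a + qform R b)"
      unfolding Ca Cb
      by (simp add: qform_add[OF symR] qform_diff[OF symR] matrix_vector_mult_scaleR
          cmod_power2 algebra_simps)
    have nn: "0 \<le> qform R w \<and> qform R (C *v w) \<le> qform R w" for w
      using posR[of w] decR[of w] by (cases "w = 0") auto
    have "0 < qform R a + qform R b \<and> qform R (C *v a) + qform R (C *v b) < qform R a + qform R b"
      using ab
    proof
      assume "a \<noteq> 0" then show ?thesis using posR[of a] decR[of a] nn[of b] by linarith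
    next
      assume "b \<noteq> 0" then show ?thesis using posR[of b] decR[of b] nn[of a] by linarith
    qed
    then have "(cmod c)\<^sup>2 < 1" unfolding eq
      using mult_less_cancel_right_pos[of "qform R a + qform R b" "(cmod c)\<^sup>2" 1] by simp
    then show "cmod c < 1" by (simp add: power_less_one_iff abs_square_less_1)
  qed
qed

lemma pd_M_stab_iff:
  fixes A :: "real^'n^'n" and B :: "real^'m^'n" and K :: "real^'n^'m"
  assumes P: "pd P"
  shows "pd (transpose (vcat (mat 1) (vcat (transpose A) (transpose B))) ** M_stab (P, K)
           ** vcat (mat 1) (vcat (transpose A) (transpose B)))
    \<longleftrightarrow> (\<forall>v. v \<noteq> 0 \<longrightarrow> qform P (transpose (A + B ** K) *v v) < qform P v)"
proof -
  have sym: "transpose P = P" using P by (simp add: pd_iff)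
  have "(P, K) \<in> Theta_stab" using P by (simp add: Theta_stab_def)
  then have M: "transpose (M_stab (P, K)) = M_stab (P, K)" by (rule M_stab_admissible)
  have "transpose (A + B ** K) *v v = transpose A *v v + transpose K *v (transpose B *v v)" for v
    by (simp add: transpose_add matrix_transpose_mul matrix_vector_mult_add_rdistrib
        matrix_vector_mul_assoc)
  then show ?thesis
    by (simp add: pd_iff qform_congruence vcat_mult_vector qform_M_stab[OF sym]
        matrix_transpose_mul M matrix_mul_assoc)
qed

section \<open>The set of data-compatible systems\<close>

context
  fixes u :: "nat \<Rightarrow> real^'m"
    and x :: "nat \<Rightarrow> real^'n"
    and \<Phi> :: "real^(1 + 't::{finite, linorder} \<times> 'n)^(1 + 't \<times> 'n)"
    and \<phi> :: "real^'t::{finite, linorder}^'t::{finite, linorder}"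
  assumes Phi: "\<Phi> \<in> Pi_set"
    and phi_sym: "transpose \<phi> = \<phi>"
    and Phi22: "block22 \<Phi> = kron \<phi> (mat 1)"
begin

section \<open>Definiteness and kernel inclusions passed from the noise model to \<open>N\<close>
  and \<open>Q\<close>\<close>

lemma transpose_Phi: "transpose \<Phi> = \<Phi>"
  using Phi by (simp add: Pi_set_def)

lemma psd_uminus_phi: "psd (- \<phi>)"
  unfolding psd_iff
proof (intro conjI allI)
  show "transpose (- \<phi>) = - \<phi>" by (simp add: transpose_uminus phi_sym)
  fix w
  \<comment> \<open>With \<open>w\<close> in every row, the form is that of \<open>- \<phi>\<close>
    at \<open>w\<close> times the number of rows.\<close>
  have "0 \<le> qform (- block22 \<Phi>) (vectorize (\<chi> i :: 'n. w))"
    using Phi by (simp add: Pi_set_def nsd_def psd_iff del: qform_uminus_matrix)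
  then show "0 \<le> qform (- \<phi>) w"
    by (simp add: Phi22 qform_kron mult_le_0_iff)
qed

lemma qform_Q22: "qform (Q22 u x \<phi>) k = qform \<phi> (transpose (vcat (X_minus x) (U_minus u)) *v k)"
  using qform_congruence[of "transpose (vcat (X_minus x) (U_minus u))" \<phi> k] by (simp add: Q22_def)

lemma transpose_Q22: "transpose (Q22 u x \<phi>) = Q22 u x \<phi>"
  by (simp add: Q22_def matrix_transpose_mul phi_sym matrix_mul_assoc)

lemma psd_uminus_Q22: "psd (- Q22 u x \<phi>)"
  using psd_uminus_phi by (simp add: psd_iff transpose_uminus transpose_Q22 qform_Q22)

lemma block22_N: "block22 (N_mat u x \<Phi>) = kron (Q22 u x \<phi>) (mat 1)"
  by (simp add: N_mat_def E_mat_def congruence_block Phi22 transpose_uminus transpose_kron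
      matrix_mult_uminus_left matrix_mult_uminus_right kron_mult Q22_def)

text \<open>For a row \<open>z\<close> of \<open>Z\<close>, the semidefinite form of
  \<open>- \<phi>\<close> vanishes at \<open>D^T z\<close>, where \<open>D\<close> stacks
  \<open>X_minus\<close> and \<open>U_minus\<close>. So \<open>Z D\<close> is in the kernel of the
  lower right block of \<Phi>, where the inclusion assumed for \<Phi> applies.\<close>

lemma block12_N_mult_eq_0:
  assumes "\<And>i. Q22 u x \<phi> *v (Z $ i) = 0"
  shows "block12 (N_mat u x \<Phi>) *v vectorize Z = 0"
proof -
  let ?D = "vcat (X_minus x) (U_minus u) :: (real^'t::{finite, linorder})^('n + 'm)"
  have "\<phi> *v (transpose ?D *v (Z $ i)) = 0" for i
  proof -
    have "qform (- \<phi>) (transpose ?D *v (Z $ i)) = 0"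
      using assms[of i] by (simp add: qform_Q22[symmetric]) (simp add: qform_def)
    then have "(- \<phi>) *v (transpose ?D *v (Z $ i)) = 0" by (rule psd_kernel[OF psd_uminus_phi])
    then show ?thesis by (simp add: matrix_vector_mult_uminus_left)
  qed
  then have "(Z ** ?D ** \<phi>) $ i = 0" for i
    using row_mult_transpose[of Z "transpose ?D" i] row_mult_transpose[of "Z ** ?D" \<phi> i]
    by (simp add: phi_sym)
  then have "Z ** ?D ** \<phi> = 0" by (simp add: vec_eq_iff)
  then have "block22 \<Phi> *v vectorize (Z ** ?D) = 0"
    by (simp add: Phi22 kron_mat1_vectorize phi_sym) (simp add: vectorize_def vec_eq_iff)
  moreover from this have "block12 \<Phi> *v vectorize (Z ** ?D) = 0"
    using Phi by (simp add: Pi_set_def)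
  ultimately show ?thesis
    by (simp add: N_mat_def E_mat_def congruence_block matrix_vector_mul_assoc[symmetric]
        matrix_vector_mult_uminus_left matrix_vector_mult_uminus_right kron_mat1_vectorize
        matrix_vector_mult_add_rdistrib)
qed

lemma transpose_N: "transpose (N_mat u x \<Phi>) = N_mat u x \<Phi>"
  by (simp add: N_mat_def matrix_transpose_mul transpose_Phi matrix_mul_assoc)

lemma block12_N: "block12 (N_mat u x \<Phi>) = transpose (columnvector (vectorize (Q12 u x \<Phi>)))"
  using block21_symmetric[OF transpose_N] by (simp add: vectorize_Q12)

lemma kernel_Q22:
  assumes k: "Q22 u x \<phi> *v k = 0"
  shows "Q12 u x \<Phi> *v k = 0"
proof -
  have "(Q12 u x \<Phi> *v k) $ i = 0" for i
  proof -
    \<comment> \<open>With \<open>k\<close> as the only nonzero row, the pairing with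
      \<open>Q12\<close> isolates entry \<open>i\<close>.\<close>
    define Z :: "real^('n + 'm)^'n" where "Z = (\<chi> l. if l = i then k else 0)"
    have "0 = (1 :: real^1) \<bullet> (block12 (N_mat u x \<Phi>) *v vectorize Z)"
      using k by (subst block12_N_mult_eq_0) (simp_all add: Z_def)
    also have "\<dots> = vectorize (Q12 u x \<Phi>) \<bullet> vectorize Z"
      by (simp add: block12_N inner_transpose_matrix columnvector_mult_1)
    also have "\<dots> = (\<Sum>l\<in>UNIV. if l = i then Q12 u x \<Phi> $ l \<bullet> k else 0)"
      by (simp only: inner_vectorize) (intro sum.cong refl, simp add: Z_def)
    also have "\<dots> = (Q12 u x \<Phi> *v k) $ i"
      by (simp add: matrix_vector_mult_def inner_vec_def)
    finally show ?thesis by simp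
  qed
  then show ?thesis by (simp add: vec_eq_iff)
qed

section \<open>Completing the square in \<open>N\<close> row by row\<close>

lemma qform_N:
  "qform (N_mat u x \<Phi>) (one_vec (vectorize Z)) = block11 (N_mat u x \<Phi>) $ 1 $ 1
    + 2 * (\<Sum>i\<in>UNIV. Z $ i \<bullet> Q12 u x \<Phi> $ i) + (\<Sum>i\<in>UNIV. qform (Q22 u x \<phi>) (Z $ i))"
proof -
  let ?N = "N_mat u x \<Phi>"
  have "?N = block (block11 ?N) (block12 ?N) (transpose (block12 ?N)) (block22 ?N)"
    by (simp only: block_blocks block21_symmetric[OF transpose_N, symmetric])
  then have "qform ?N (one_vec (vectorize Z)) = qform (block11 ?N) 1
      + 2 * (vectorize Z \<bullet> (transpose (block12 ?N) *v 1)) + qform (block22 ?N) (vectorize Z)"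
    by (metis one_vec_vjoin qform_block_symmetric)
  then show ?thesis
    by (simp add: qform_1 block12_N columnvector_mult_1 inner_vectorize block22_N qform_kron)
qed

text \<open>The pseudoinverse of the lower right block is again a Kronecker product with the
  identity, so the correction term splits over the rows of \<open>Q12\<close>.\<close>

lemma gen_schur_N:
  "gen_schur (N_mat u x \<Phi>) $ 1 $ 1 = block11 (N_mat u x \<Phi>) $ 1 $ 1
    - (\<Sum>i\<in>UNIV. qform (pinv (Q22 u x \<phi>)) (Q12 u x \<Phi> $ i))"
proof -
  let ?N = "N_mat u x \<Phi>" and ?q = "columnvector (vectorize (Q12 u x \<Phi>)) :: real^1^(('n + 'm) \<times> 'n)"
  have "is_pinv (Q22 u x \<phi>) (pinv (Q22 u x \<phi>))"
    by (intro is_pinv_pinv ex_is_pinv_symmetric transpose_Q22)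
  then have G: "pinv (block22 ?N) = kron (pinv (Q22 u x \<phi>)) (mat 1)"
    unfolding block22_N by (intro pinv_eqI is_pinv_kron)
  have "gen_schur ?N $ 1 $ 1
      = block11 ?N $ 1 $ 1 - (transpose ?q ** kron (pinv (Q22 u x \<phi>)) (mat 1) ** ?q) $ 1 $ 1"
    by (simp add: gen_schur_def G block12_N block21_symmetric[OF transpose_N])
  also have "(transpose ?q ** kron (pinv (Q22 u x \<phi>)) (mat 1) ** ?q) $ 1 $ 1
      = (\<Sum>i\<in>UNIV. qform (pinv (Q22 u x \<phi>)) (Q12 u x \<Phi> $ i))"
    by (simp only: qform_1[symmetric] qform_congruence columnvector_mult_1 qform_kron)
  finally show ?thesis .
qed

text \<open>Stored as the transpose of the central system, so that \<open>center *v v\<close> is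
  comparable with \<open>[A B]^T v\<close>.\<close>

definition "center = - transpose (Q12 u x \<Phi> ** pinv (Q22 u x \<phi>))"

lemma qform_Q_mat:
  "qform (Q_mat u x \<Phi> \<phi>) (vjoin v y)
    = gen_schur (N_mat u x \<Phi>) $ 1 $ 1 * (v \<bullet> v) - qform (- Q22 u x \<phi>) (y - center *v v)"
  unfolding Q_mat_def
  using complete_square[OF transpose_Q22 kernel_Q22 center_def] by simp

lemma transpose_Q_mat: "transpose (Q_mat u x \<Phi> \<phi>) = Q_mat u x \<Phi> \<phi>"
proof -
  have "transpose (a *\<^sub>R mat 1 + M :: real^'n^'n) = a *\<^sub>R mat 1 + transpose M" for a M
    by (simp add: transpose_def vec_eq_iff mat_def eq_commute)
  then show ?thesis
    by (simp add: Q_mat_def transpose_block transpose_Q22 matrix_transpose_mul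
        transpose_pinv_symmetric matrix_mul_assoc)
qed

text \<open>The residual is determined by the system, so membership is a single sign condition on
  the form of \<open>N\<close>; completing the square in each row of \<open>[A B]\<close> turns it
  into a ball.\<close>

lemma Sigma_D_iff:
  "(A, B) \<in> Sigma_D u x (W_F \<Phi>) \<longleftrightarrow>
    (\<Sum>i\<in>UNIV. qform (- Q22 u x \<phi>) ((hcat A B - transpose center) $ i))
      \<le> gen_schur (N_mat u x \<Phi>) $ 1 $ 1"
proof -
  let ?S = "Q22 u x \<phi>" and ?q = "Q12 u x \<Phi>" and ?Z = "hcat A B" and ?N = "N_mat u x \<Phi>"
  let ?W = "X_plus x - (A ** X_minus x + B ** U_minus u) :: (real^'t::{finite, linorder})^'n"
  have "(A, B) \<in> Sigma_D u x (W_F \<Phi>) \<longleftrightarrow> ?W \<in> W_F \<Phi>"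
  proof -
    have "X_plus x = A ** X_minus x + B ** U_minus u + W \<longleftrightarrow> W = ?W" for W
      by (auto simp: algebra_simps)
    then show ?thesis by (simp add: Sigma_D_def)
  qed
  also have "\<dots> \<longleftrightarrow> 0 \<le> qform ?N (one_vec (vectorize ?Z))"
    unfolding N_mat_def qform_congruence E_mat_one_vec by (simp add: W_F_def qform_def)
  also have "qform ?N (one_vec (vectorize ?Z)) = gen_schur ?N $ 1 $ 1
      - (\<Sum>i\<in>UNIV. qform (- ?S) ((?Z - transpose center) $ i))"
  proof -
    have "qform (- ?S) ((?Z - transpose center) $ i)
        = - qform ?S (?Z $ i) - 2 * (?Z $ i \<bullet> ?q $ i) - qform (pinv ?S) (?q $ i)" for i
    proof -
      have c: "?S *v (center *v axis i 1) = - (?q $ i)"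
        using center_eq[OF transpose_Q22 kernel_Q22 center_def, of "axis i 1"]
          transpose_nth[of "transpose ?q" i] by simp
      have "qform ?S (center *v axis i 1) = qform (?q ** pinv ?S ** transpose ?q) (axis i 1)"
        using qform_center[OF transpose_Q22 kernel_Q22 center_def] by simp
      also have "\<dots> = qform (pinv ?S) (?q $ i)"
        using qform_congruence[of "transpose ?q" "pinv ?S" "axis i 1"]
          transpose_nth[of "transpose ?q" i] by simp
      finally show ?thesis
        by (simp add: transpose_nth qform_diff[OF transpose_Q22] c)
    qed
    then show ?thesis
      by (simp add: gen_schur_N qform_N sum_subtractf sum_negf sum_distrib_left)
  qed
  finally show ?thesis by simp
qed

section \<open>The matrix inequality and the Lyapunov inequality for all compatible systems\<close>

lemma LMI_stab_iff:
  fixes P :: "real^'n^'n" and K :: "real^'n^'m"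
  assumes P: "transpose P = P"
  shows "LMI_stab P (K ** P) \<beta> (Q_mat u x \<Phi> \<phi>) \<longleftrightarrow>
    (\<forall>v a b c. 0 \<le> qform P v - \<beta> * (v \<bullet> v) - qform P (a + transpose K *v b)
      + qform P (c + transpose K *v b) - qform (Q_mat u x \<Phi> \<phi>) (vjoin v (vjoin a b)))"
  (is "?L \<longleftrightarrow> ?R")
proof -
  have "?L \<longleftrightarrow> (\<forall>z. 0 \<le> qform (block
       (block (P - \<beta> *\<^sub>R mat 1) 0 0 (block (- P) (- transpose (K ** P)) (- (K ** P)) 0))
       (vcat 0 (vcat 0 (K ** P))) (hcat 0 (hcat 0 (transpose (K ** P)))) P
     - block (Q_mat u x \<Phi> \<phi>) 0 0 0) z)" (is "_ \<longleftrightarrow> (\<forall>z. 0 \<le> qform ?M z)")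
    unfolding LMI_stab_def psd_iff
    using transpose_LMI[OF P transpose_Q_mat] by blast
  also have "\<dots> \<longleftrightarrow> (\<forall>v a b c. 0 \<le> qform ?M (vjoin (vjoin v (vjoin a b)) c))"
    by (metis vjoin_cases)
  also have "\<dots> \<longleftrightarrow> ?R" by (simp only: qform_LMI[OF P refl refl])
  finally show ?thesis .
qed

lemma LMI_imp_lyapunov:
  assumes P: "pd P" and \<beta>: "\<beta> > 0" and LMI: "LMI_stab P L \<beta> (Q_mat u x \<Phi> \<phi>)"
    and AB: "(A, B) \<in> Sigma_D u x (W_F \<Phi>)" and v: "v \<noteq> 0"
  shows "qform P (transpose (A + B ** (L ** matrix_inv P)) *v v) < qform P v"
proof -
  let ?R = "- Q22 u x \<phi>" and ?C = "center" and ?s = "gen_schur (N_mat u x \<Phi>) $ 1 $ 1"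
  have sym: "transpose P = P" using P by (simp add: pd_iff)
  define K where "K = L ** matrix_inv P"
  have L: "K ** P = L"
    unfolding K_def by (simp add: matrix_mul_assoc[symmetric] pd_invertible[OF P])
  define a b where "a = transpose A *v v" and "b = transpose B *v v"
  define \<Delta> where "\<Delta> = hcat A B - transpose ?C"
  have y: "vjoin a b - ?C *v v = transpose \<Delta> *v v"
    by (simp add: \<Delta>_def a_def b_def transpose_diff transpose_hcat vcat_mult_vector
        matrix_vector_mult_diff_rdistrib)
  have "qform ?R (transpose \<Delta> *v v) \<le> (v \<bullet> v) * (\<Sum>i\<in>UNIV. qform ?R (\<Delta> $ i))"
    by (rule qform_transpose_mult_le) (rule psd_uminus_Q22)
  also have "\<dots> \<le> (v \<bullet> v) * ?s"
    using AB unfolding \<Delta>_def Sigma_D_iff by (intro mult_left_mono) simp_all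
  finally have Q: "0 \<le> qform (Q_mat u x \<Phi> \<phi>) (vjoin v (vjoin a b))"
    unfolding qform_Q_mat y by (simp add: mult.commute)
  \<comment> \<open>The choice \<open>c = - K^T b\<close> annihilates the square in
    \<open>c\<close>.\<close>
  have "0 \<le> qform P v - \<beta> * (v \<bullet> v) - qform P (a + transpose K *v b)
      + qform P (- (transpose K *v b) + transpose K *v b) - qform (Q_mat u x \<Phi> \<phi>) (vjoin v (vjoin a b))"
    using LMI LMI_stab_iff[OF sym, of K \<beta>] unfolding L by blast
  then have "qform P (a + transpose K *v b) + \<beta> * (v \<bullet> v) \<le> qform P v"
    using Q by simp
  moreover have "0 < \<beta> * (v \<bullet> v)" using \<beta> v by simp
  moreover have "transpose (A + B ** K) *v v = a + transpose K *v b"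
    by (simp add: a_def b_def transpose_add matrix_transpose_mul matrix_vector_mult_add_rdistrib
        matrix_vector_mul_assoc)
  ultimately show ?thesis unfolding K_def by simp
qed

lemma lyapunov_imp_LMI:
  assumes true_system: "Sigma_D u x (W_F \<Phi>) \<noteq> {}"
    and P: "pd P"
    and dec: "\<And>A B v. (A, B) \<in> Sigma_D u x (W_F \<Phi>) \<Longrightarrow> v \<noteq> 0
      \<Longrightarrow> qform P (transpose (A + B ** K) *v v) < qform P v"
  shows "\<exists>P L \<beta>. pd P \<and> \<beta> > 0 \<and> LMI_stab P L \<beta> (Q_mat u x \<Phi> \<phi>)"
proof -
  let ?R = "- Q22 u x \<phi>" and ?C = "center" and ?s = "gen_schur (N_mat u x \<Phi>) $ 1 $ 1"
  have sym: "transpose P = P" and pos: "\<And>v. v \<noteq> 0 \<Longrightarrow> 0 < qform P v"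
    and nn: "\<And>v. 0 \<le> qform P v"
    using P pd_imp_psd[OF P] by (auto simp: pd_iff psd_iff)
  have R: "psd ?R" by (rule psd_uminus_Q22)
  \<comment> \<open>\<open>G\<close> maps \<open>[A B]^T v\<close> to \<open>(A + B K)^T v\<close>,
    so \<open>F\<close> measures the closed loop in terms of \<open>[A B]^T v\<close>.\<close>
  define G where "G = transpose (vcat (mat 1) K)"
  have G: "G *v vjoin a b = a + transpose K *v b" for a b
    by (simp add: G_def transpose_vcat hcat_mult_vjoin)
  define F where "F = transpose G ** P ** G"
  have F: "qform F y = qform P (G *v y)" for y unfolding F_def by (rule qform_congruence)
  have psdF: "psd F"
    unfolding psd_iff F by (simp add: nn F_def matrix_transpose_mul sym matrix_mul_assoc)
  \<comment> \<open>A nonempty ball has nonnegative radius.\<close>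
  have s: "0 \<le> ?s"
  proof -
    obtain A B where "(A, B) \<in> Sigma_D u x (W_F \<Phi>)" using true_system by auto
    moreover have "0 \<le> (\<Sum>i\<in>UNIV. qform ?R ((hcat A B - transpose ?C) $ i))"
      using R unfolding psd_iff by (intro sum_nonneg) blast
    ultimately show ?thesis unfolding Sigma_D_iff by linarith
  qed
  have H: "0 < qform P v - qform F (?C *v v + w)" if v: "v \<noteq> 0" and w: "qform ?R w \<le> ?s * (v \<bullet> v)" for v w
  proof -
    obtain \<Delta> :: "real^('n + 'm)^'n" where \<Delta>: "transpose \<Delta> *v v = w"
      "\<And>R. (\<Sum>i\<in>UNIV. qform R (\<Delta> $ i)) = qform R w / (v \<bullet> v)"
      using rank_one_perturbation[OF v] by blast
    \<comment> \<open>Shifting the centre by \<Delta> gives a compatible system with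
      \<open>[A B]^T v = center v + w\<close>.\<close>
    define Z where "Z = transpose ?C + \<Delta>"
    define A B where "A = (\<chi> i j. Z $ i $ Inl j)" and "B = (\<chi> i j. Z $ i $ Inr j)"
    have Z: "hcat A B = Z"
      by (auto simp: hcat_def A_def B_def vec_eq_iff split: sum.split)
    have "qform ?R w / (v \<bullet> v) \<le> ?s" using v w by (simp add: divide_le_eq del: qform_uminus_matrix)
    then have AB: "(A, B) \<in> Sigma_D u x (W_F \<Phi>)"
      unfolding Sigma_D_iff Z by (simp only: Z_def add_diff_cancel_left' \<Delta>(2))
    have "?C *v v + w = transpose (hcat A B) *v v"
      unfolding Z Z_def by (simp add: transpose_add matrix_vector_mult_add_rdistrib \<Delta>(1))
    then have "G *v (?C *v v + w) = transpose (A + B ** K) *v v"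
      by (simp add: transpose_hcat vcat_mult_vector G transpose_add matrix_transpose_mul
          matrix_vector_mult_add_rdistrib matrix_vector_mul_assoc)
    then show ?thesis using dec[OF AB v] by (simp add: F)
  qed
  obtain \<alpha> s' where \<alpha>: "0 \<le> \<alpha>" and s': "?s < s'" and
    ineq: "\<And>v w. \<alpha> * (s' * (v \<bullet> v) - qform ?R w) \<le> qform P v - qform F (?C *v v + w)"
    using robust_multiplier[OF sym psdF R s H] by blast
  \<comment> \<open>At \<open>v = 0\<close> and \<open>w = (e, 0)\<close> with a unit vector
    \<open>e\<close>, a zero multiplier would give \<open>qform P e <= 0\<close>.\<close>
  have "\<alpha> \<noteq> 0"
  proof
    assume "\<alpha> = 0"
    then have "0 \<le> - qform P (axis undefined 1)"
      using ineq[of 0 "vjoin (axis undefined 1) 0"] by (simp add: F G)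
    moreover have "0 < qform P (axis undefined 1)" by (intro pos) (simp add: axis_eq_0_iff)
    ultimately show False by simp
  qed
  with \<alpha> have \<alpha>: "0 < \<alpha>" by simp
  \<comment> \<open>Dividing by \<alpha> normalizes the multiplier to 1, the coefficient of
    \<open>Q\<close> in the matrix inequality.\<close>
  define P' where "P' = (1 / \<alpha>) *\<^sub>R P"
  have P': "qform P' v = qform P v / \<alpha>" for v
    by (simp add: P'_def qform_def scaleR_matrix_vector_assoc[symmetric])
  have sym': "transpose P' = P'" using sym by (simp add: P'_def transpose_def vec_eq_iff)
  have "pd P'" using pos \<alpha> by (simp add: pd_iff sym' P')
  moreover have "0 < s' - ?s" using s' by simp
  \<comment> \<open>The form of \<open>Q\<close> carries \<open>s\<close> where the multiplier
    inequality has \<open>s'\<close>; the gap is the witness for \<beta>.\<close>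
  moreover have "LMI_stab P' (K ** P') (s' - ?s) (Q_mat u x \<Phi> \<phi>)"
    unfolding LMI_stab_iff[OF sym']
  proof (intro allI)
    fix v a b c
    let ?k = "transpose K *v b" and ?w = "vjoin a b - ?C *v v"
    have "qform F (?C *v v + ?w) = qform P (a + ?k)" by (simp add: F G)
    then have "\<alpha> * (s' * (v \<bullet> v) - qform ?R ?w) \<le> qform P v - qform P (a + ?k)"
      using ineq[of v ?w] by simp
    then have "s' * (v \<bullet> v) - qform ?R ?w \<le> qform P' v - qform P' (a + ?k)"
      using \<alpha> by (simp add: P' field_simps)
    moreover have "0 \<le> qform P' (c + ?k)" using nn \<alpha> by (simp add: P')
    ultimately show "0 \<le> qform P' v - (s' - ?s) * (v \<bullet> v) - qform P' (a + ?k)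
      + qform P' (c + ?k) - qform (Q_mat u x \<Phi> \<phi>) (vjoin v (vjoin a b))"
      unfolding qform_Q_mat by (simp add: left_diff_distrib)
  qed
  ultimately show ?thesis by blast
qed

end

theorem theorem4:
  fixes u :: "nat \<Rightarrow> real^'m"
    and x :: "nat \<Rightarrow> real^'n"
    and \<Phi> :: "real^(1 + 't::{finite, linorder} \<times> 'n)^(1 + 't \<times> 'n)"
    and \<phi> :: "real^'t::{finite, linorder}^'t::{finite, linorder}"
    and A\<^sub>s :: "real^'n^'n"
    and B\<^sub>s :: "real^'m^'n"
  assumes Phi: "\<Phi> \<in> Pi_set"
    and phi_sym: "transpose \<phi> = \<phi>"
    and Phi22: "block22 \<Phi> = kron \<phi> (mat 1)"
    and true_system: "(A\<^sub>s, B\<^sub>s) \<in> Sigma_D u x (W_F \<Phi>)"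
  shows "(informative (Theta_stab :: ((real^'n^'n) \<times> (real^'n^'m)) set) M_stab u x (W_F \<Phi>)
            \<longleftrightarrow> (\<exists>(P :: real^'n^'n) (L :: real^'n^'m) \<beta>.
                  pd P \<and> \<beta> > 0 \<and> LMI_stab P L \<beta> (Q_mat u x \<Phi> \<phi>)))
       \<and> (\<forall>(P :: real^'n^'n) (L :: real^'n^'m) \<beta>.
            pd P \<and> \<beta> > 0 \<and> LMI_stab P L \<beta> (Q_mat u x \<Phi> \<phi>)
            \<longrightarrow> (\<forall>(A, B) \<in> Sigma_D u x (W_F \<Phi>). schur_stable (A + B ** (L ** matrix_inv P))))"
proof -
  note lyapunov = LMI_imp_lyapunov[OF Phi phi_sym Phi22]
  have informative: "informative (Theta_stab :: ((real^'n^'n) \<times> (real^'n^'m)) set) M_stab u x (W_F \<Phi>)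
      \<longleftrightarrow> (\<exists>(P :: real^'n^'n) (K :: real^'n^'m). pd P \<and> (\<forall>(A, B) \<in> Sigma_D u x (W_F \<Phi>).
            \<forall>v. v \<noteq> 0 \<longrightarrow> qform P (transpose (A + B ** K) *v v) < qform P v))"
    (is "?I \<longleftrightarrow> ?J")
    by (simp add: informative_def Theta_stab_def Bex_def split_paired_Ex pd_M_stab_iff
        cong: conj_cong)
  show ?thesis
  proof (intro conjI iffI allI impI)
    assume ?I
    then obtain P :: "real^'n^'n" and K :: "real^'n^'m" where P: "pd P"
      and dec: "\<And>A B v. (A, B) \<in> Sigma_D u x (W_F \<Phi>) \<Longrightarrow> v \<noteq> 0
        \<Longrightarrow> qform P (transpose (A + B ** K) *v v) < qform P v"
      unfolding informative by blast
    show "\<exists>(P :: real^'n^'n) (L :: real^'n^'m) \<beta>. pd P \<and> \<beta> > 0 \<and> LMI_stab P L \<beta> (Q_mat u x \<Phi> \<phi>)"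
      using true_system by (intro lyapunov_imp_LMI[OF Phi phi_sym Phi22 _ P dec]) auto
  next
    assume "\<exists>(P :: real^'n^'n) (L :: real^'n^'m) \<beta>. pd P \<and> \<beta> > 0 \<and> LMI_stab P L \<beta> (Q_mat u x \<Phi> \<phi>)"
    \<comment> \<open>The gain witnessing informativity is \<open>L ** matrix_inv P\<close>, with
      the same \<open>P\<close>.\<close>
    then show ?I
      unfolding informative using lyapunov by fast
  next
    fix P :: "real^'n^'n" and L :: "real^'n^'m" and \<beta>
    assume "pd P \<and> \<beta> > 0 \<and> LMI_stab P L \<beta> (Q_mat u x \<Phi> \<phi>)"
    then show "\<forall>(A, B) \<in> Sigma_D u x (W_F \<Phi>). schur_stable (A + B ** (L ** matrix_inv P))"
      using lyapunov schur_stable_if_lyapunov[of P] by fast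
  qed
qed

end
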